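(* Let $s,n\in\mathbb N$ with $s\le n$ and let $p,q,R,\eta>0$ satisfy $$q\le\tfrac1{16},\qquad p\le\frac{q}{2^{10}s^2},\qquad R\ge2^{-6}pn,\qquad \eta=2^{-2s-2}.$$ For every $s$-uniform hypergraph $\mathcal H$ with $n$ vertices there is a family $\mathcal X\subset 2^{V(\mathcal H)}$ with $|\mathcal X|\le4(2/q)^{8qn}$ such that: (i) if $L\subset V(\mathcal H)$ and $\mathcal H[L]$ is not $(p/q,\eta R)$-Janson, then $L\subset X$ for some $X\in\mathcal X$; (ii) for each $X\in\mathcal X$, $\mathcal H[X]$ is not $(p,R)$-Janson.
   Context: A hypergraph is identified with its edge set; $\mathcal H[L]=\{E\in\mathcal H:E\subset L\}$ with vertex set $L$. For $\nu:\mathcal G\to\mathbb R_{\ge0}$: $e(\nu)=\sum_{E\in\mathcal G}\nu(E)$, $d_\nu(L)=\sum_{E\in\mathcal G,L\subset E}\nu(E)$, $\Lambda_p(\nu)=\sum_{L\subset V(\mathcal G),|L|\ge2}d_\nu(L)^2p^{-|L|}$. For $p,R>0$, $\mathcal G$ is $(p,R)$-Janson if there exists $\nu:\mathcal G\to\mathbb R_{\ge0}$ with $\Lambda_p(\nu)<e(\nu)^2/R$. *)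

theory Defs
  imports Complex_Main
begin

text \<open>A hypergraph is its edge set; induced subhypergraph on L, with vertex set L.\<close>
definition induced :: "'a set set \<Rightarrow> 'a set \<Rightarrow> 'a set set" where
  "induced H L = {E \<in> H. E \<subseteq> L}"

definition e_weight :: "'a set set \<Rightarrow> ('a set \<Rightarrow> real) \<Rightarrow> real" where
  "e_weight G \<nu> = (\<Sum>E\<in>G. \<nu> E)"

definition deg_weight :: "'a set set \<Rightarrow> ('a set \<Rightarrow> real) \<Rightarrow> 'a set \<Rightarrow> real" where
  "deg_weight G \<nu> L = (\<Sum>E\<in>{E \<in> G. L \<subseteq> E}. \<nu> E)"

definition Lambda :: "'a set \<Rightarrow> 'a set set \<Rightarrow> real \<Rightarrow> ('a set \<Rightarrow> real) \<Rightarrow> real" where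
  "Lambda V G p \<nu> = (\<Sum>L\<in>{L. L \<subseteq> V \<and> 2 \<le> card L}. (deg_weight G \<nu> L)^2 * p powr (- real (card L)))"

definition janson :: "'a set \<Rightarrow> 'a set set \<Rightarrow> real \<Rightarrow> real \<Rightarrow> bool" where
  "janson V G p R \<longleftrightarrow> (\<exists>\<nu>::'a set \<Rightarrow> real. (\<forall>E\<in>G. 0 \<le> \<nu> E) \<and>
      Lambda V G p \<nu> < (e_weight G \<nu>)^2 / R)"

end

theory Submission
  imports Defs
begin

text \<open>
  Write \<open>V\<^sub>q\<close> for the random subset of \<open>V\<close> that contains each vertex independently with probability
  \<open>q\<close>. For a family \<open>F\<close> closed under subsets, each \<open>L \<in> F\<close> has a small fingerprint \<open>S \<subseteq> L\<close>, a minimiser of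
  \<open>P(V\<^sub>q \<union> S \<in> F) / \<delta>\<^bsup>|S|\<^esup>\<close>: every \<open>T \<subseteq> L\<close> then has probability at least \<open>(\<delta>q)\<^bsup>|T|\<^esup>\<close> of lying in \<open>V\<^sub>q\<close>
  conditioned on \<open>V\<^sub>q \<union> S \<in> F\<close>. This is used twice: with density \<open>q\<close> and \<open>\<delta> = 1/2\<close> for the family of
  \<open>L\<close> such that \<open>H[L]\<close> is not \<open>(p/q, \<eta>R)\<close>-Janson, and then with density \<open>\<lambda> = 2q/s\<close> and \<open>\<delta> = 1 - 1/(2s)\<close>
  for the family \<open>F\<^sub>2\<close> of sets all of whose subsets \<open>T\<close> satisfy the first bound. The container consists of the
  vertices whose conditional probability in the second step is at least \<open>(1 - 1/(2s))\<lambda>\<close>.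

  Suppose that \<open>\<nu>\<close> shows that the container \<open>X\<close> is \<open>(p, R)\<close>-Janson. The conditioned first random set always
  spans a hypergraph that is not \<open>(p/q, \<eta>R)\<close>-Janson, while Harris' inequality bounds the expectation of
  \<open>\<Lambda>\<close> on it by its value for \<open>V\<^sub>q\<close>; so edges in \<open>F\<^sub>2\<close> carry less than three quarters of \<open>\<nu>\<close>. The conditioned
  second random set contains no edge outside \<open>F\<^sub>2\<close>, but its vertex marginals are almost \<open>\<lambda>\<close>; building up
  edges one vertex at a time, with a second moment bound and Harris' inequality in place of independence,
  shows that such edges carry at most a quarter of \<open>\<nu>\<close>.
\<close>

section \<open>Expectations over binomial random subsets\<close>

text \<open>A finite weighted sum instead of a measure: the linear identities hold for every real
  \<open>q\<close>, and only the order and correlation bounds need \<open>0 \<le> q\<close> and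
  \<open>q \<le> 1\<close>.\<close>

definition bexp :: "real \<Rightarrow> 'a set \<Rightarrow> ('a set \<Rightarrow> real) \<Rightarrow> real" where
  "bexp q V f = (\<Sum>U\<in>Pow V. q ^ card U * (1 - q) ^ card (V - U) * f U)"

lemma bexp_empty [simp]: "bexp q {} f = f {}"
  by (simp add: bexp_def)

lemma bexp_insert:
  assumes "finite V" "v \<notin> V"
  shows "bexp q (insert v V) f = (1 - q) * bexp q V f + q * bexp q V (\<lambda>U. f (insert v U))"
proof -
  have inj: "inj_on (insert v) (Pow V)"
    using assms(2) by (auto simp: inj_on_def)
  have disj: "Pow V \<inter> insert v ` Pow V = {}"
    using assms(2) by auto
  have *: "card (insert v U) = Suc (card U)" "card (insert v V - U) = Suc (card (V - U))"
    "insert v V - insert v U = V - U" "V - insert v U = V - U" if "U \<subseteq> V" for U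
  proof -
    have "finite U" "v \<notin> U" using that assms finite_subset by auto
    then show "card (insert v U) = Suc (card U)" by simp
    have "insert v V - U = insert v (V - U)" using \<open>v \<notin> U\<close> by auto
    then show "card (insert v V - U) = Suc (card (V - U))" using assms by simp
    show "insert v V - insert v U = V - U" "V - insert v U = V - U" using assms by auto
  qed
  have "bexp q (insert v V) f =
      (\<Sum>U\<in>Pow V. q ^ card U * (1 - q) ^ card (insert v V - U) * f U) +
      (\<Sum>U\<in>Pow V. q ^ card (insert v U) * (1 - q) ^ card (insert v V - insert v U) * f (insert v U))"
    unfolding bexp_def Pow_insert using assms disj inj
    by (subst sum.union_disjoint) (auto simp: sum.reindex)
  also have "\<dots> = (1 - q) * bexp q V f + q * bexp q V (\<lambda>U. f (insert v U))"
    unfolding bexp_def sum_distrib_left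
    by (intro arg_cong2[where f = "(+)"] sum.cong) (simp_all add: *)
  finally show ?thesis .
qed

lemma bexp_add: "bexp q V (\<lambda>U. f U + g U) = bexp q V f + bexp q V g"
  by (simp add: bexp_def sum.distrib algebra_simps)

lemma bexp_diff: "bexp q V (\<lambda>U. f U - g U) = bexp q V f - bexp q V g"
  by (simp add: bexp_def sum_subtractf algebra_simps)

lemma bexp_cmult: "bexp q V (\<lambda>U. c * f U) = c * bexp q V f"
  by (simp add: bexp_def sum_distrib_left algebra_simps)

lemma bexp_sum: "bexp q V (\<lambda>U. \<Sum>i\<in>I. f i U) = (\<Sum>i\<in>I. bexp q V (f i))"
  unfolding bexp_def sum_distrib_left by (rule sum.swap)

lemma bexp_const: "finite V \<Longrightarrow> bexp q V (\<lambda>_. c) = c"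
  by (induction V rule: finite_induct) (simp_all add: bexp_insert algebra_simps)

lemma bexp_cong: "(\<And>U. U \<subseteq> V \<Longrightarrow> f U = g U) \<Longrightarrow> bexp q V f = bexp q V g"
  unfolding bexp_def by (intro sum.cong) auto

lemma bexp_mono:
  assumes "0 \<le> q" "q \<le> 1" "\<And>U. U \<subseteq> V \<Longrightarrow> f U \<le> g U"
  shows "bexp q V f \<le> bexp q V g"
  unfolding bexp_def using assms by (intro sum_mono mult_left_mono) auto

lemma bexp_nonneg:
  assumes "0 \<le> q" "q \<le> 1" "\<And>U. U \<subseteq> V \<Longrightarrow> 0 \<le> f U"
  shows "0 \<le> bexp q V f"
  unfolding bexp_def using assms by (intro sum_nonneg mult_nonneg_nonneg) auto

text \<open>Conditioning on \<open>v \<in> U\<close> leaves the other vertices independent. As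
  \<open>f (insert v U)\<close> does not see whether \<open>v \<in> U\<close>, the right-hand
  average may still run over subsets of all of \<open>V\<close>.\<close>

lemma bexp_member:
  assumes "finite V" "v \<in> V"
  shows "bexp q V (\<lambda>U. of_bool (v \<in> U) * f U) = q * bexp q V (\<lambda>U. f (insert v U))"
proof -
  obtain W where W: "V = insert v W" "v \<notin> W" "finite W"
    using assms by (metis finite_insert mk_disjoint_insert)
  have "bexp q W (\<lambda>U. of_bool (v \<in> U) * f U) = bexp q W (\<lambda>U. 0)"
    using W by (intro bexp_cong) auto
  then show ?thesis
    using W by (simp add: bexp_insert bexp_const algebra_simps)
qed

lemma bexp_superset:
  assumes "finite V" "T \<subseteq> V"
  shows "bexp q V (\<lambda>U. of_bool (T \<subseteq> U) * f U) = q ^ card T * bexp q V (\<lambda>U. f (U \<union> T))"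
proof -
  have "finite T" using assms finite_subset by blast
  then show ?thesis using assms(2)
  proof (induction T arbitrary: f rule: finite_induct)
    case (insert v T)
    have "bexp q V (\<lambda>U. of_bool (insert v T \<subseteq> U) * f U)
        = bexp q V (\<lambda>U. of_bool (v \<in> U) * (of_bool (T \<subseteq> U) * f U))"
      by (intro bexp_cong) auto
    also have "\<dots> = q * bexp q V (\<lambda>U. of_bool (T \<subseteq> insert v U) * f (insert v U))"
      using insert.prems assms(1) by (subst bexp_member) auto
    also have "\<dots> = q * bexp q V (\<lambda>U. of_bool (T \<subseteq> U) * f (insert v U))"
      using insert.hyps by (simp add: subset_insert)
    also have "\<dots> = q ^ card (insert v T) * bexp q V (\<lambda>U. f (insert v (U \<union> T)))"
      using insert.prems insert.hyps by (subst insert.IH) auto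
    finally show ?case by simp
  qed simp
qed

lemma bexp_prob_superset:
  assumes "finite V" "T \<subseteq> V"
  shows "bexp q V (\<lambda>U. of_bool (T \<subseteq> U)) = q ^ card T"
  using bexp_superset[OF assms, of q "\<lambda>_. 1"] assms(1) by (simp add: bexp_const)

text \<open>Induction on \<open>V\<close>: splitting on whether \<open>v\<close> is chosen reduces
  the claim to a two-point inequality between the conditional means.\<close>

lemma bexp_harris:
  assumes "finite V" "0 \<le> q" "q \<le> 1"
    and "\<And>A B. A \<subseteq> B \<Longrightarrow> B \<subseteq> V \<Longrightarrow> f A \<le> f B"
    and "\<And>A B. A \<subseteq> B \<Longrightarrow> B \<subseteq> V \<Longrightarrow> g B \<le> g A"
  shows "bexp q V (\<lambda>U. f U * g U) \<le> bexp q V f * bexp q V g"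
  using assms(1,4,5)
proof (induction V arbitrary: f g rule: finite_induct)
  case (insert v V)
  let ?f = "\<lambda>U. f (insert v U)" and ?g = "\<lambda>U. g (insert v U)"
  let ?a = "bexp q V f" and ?b = "bexp q V ?f" and ?c = "bexp q V g" and ?d = "bexp q V ?g"
  have 1: "bexp q V (\<lambda>U. f U * g U) \<le> ?a * ?c"
    by (rule insert.IH) (use insert.prems in \<open>simp_all add: subset_insertI2\<close>)
  have 2: "bexp q V (\<lambda>U. ?f U * ?g U) \<le> ?b * ?d"
    by (rule insert.IH) (use insert.prems in \<open>auto intro!: insert.prems\<close>)
  have "?a \<le> ?b" "?d \<le> ?c"
    using assms(2,3) by (auto intro!: bexp_mono insert.prems)
  \<comment> \<open>Adding \<open>v\<close> raises the mean of \<open>f\<close> and lowers that of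
    \<open>g\<close>; this product is exactly the gap in the two-point inequality.\<close>
  then have "0 \<le> q * (1 - q) * ((?b - ?a) * (?c - ?d))"
    using assms(2,3) by simp
  also have "\<dots> = ((1 - q) * ?a + q * ?b) * ((1 - q) * ?c + q * ?d)
      - ((1 - q) * (?a * ?c) + q * (?b * ?d))"
    by (simp add: algebra_simps)
  finally have "(1 - q) * (?a * ?c) + q * (?b * ?d)
      \<le> ((1 - q) * ?a + q * ?b) * ((1 - q) * ?c + q * ?d)" by simp
  moreover have "(1 - q) * bexp q V (\<lambda>U. f U * g U) + q * bexp q V (\<lambda>U. ?f U * ?g U)
      \<le> (1 - q) * (?a * ?c) + q * (?b * ?d)"
    using 1 2 assms(2,3) by (intro add_mono mult_left_mono) auto
  ultimately show ?case
    using insert.hyps by (simp add: bexp_insert)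
qed simp

section \<open>Down-sets and their fingerprints\<close>

definition downset :: "'a set \<Rightarrow> ('a set \<Rightarrow> bool) \<Rightarrow> bool" where
  "downset V F \<longleftrightarrow> (\<forall>A B. A \<subseteq> B \<longrightarrow> B \<subseteq> V \<longrightarrow> F B \<longrightarrow> F A)"

lemma downsetD: "downset V F \<Longrightarrow> F B \<Longrightarrow> A \<subseteq> B \<Longrightarrow> B \<subseteq> V \<Longrightarrow> F A"
  by (auto simp: downset_def)

definition ext_prob :: "real \<Rightarrow> 'a set \<Rightarrow> ('a set \<Rightarrow> bool) \<Rightarrow> 'a set \<Rightarrow> real" where
  "ext_prob q V F S = bexp q V (\<lambda>U. of_bool (F (U \<union> S)))"

lemma ext_prob_le_1: "finite V \<Longrightarrow> 0 \<le> q \<Longrightarrow> q \<le> 1 \<Longrightarrow> ext_prob q V F S \<le> 1"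
  unfolding ext_prob_def by (rule order.trans[OF bexp_mono[where g = "\<lambda>_. 1"]]) (auto simp: bexp_const)

lemma ext_prob_ge:
  assumes "finite V" "0 \<le> q" "q \<le> 1" "F S"
  shows "(1 - q) ^ card V \<le> ext_prob q V F S"
proof -
  have "(\<Sum>U\<in>{{}}. q ^ card U * (1 - q) ^ card (V - U) * of_bool (F (U \<union> S))) \<le> ext_prob q V F S"
    unfolding ext_prob_def bexp_def using assms by (intro sum_mono2) auto
  then show ?thesis using assms by simp
qed

text \<open>Links enlarging \<open>S\<close> by \<open>T\<close> with conditioning on
  \<open>T \<subseteq> U\<close>: a ratio of \<open>ext_prob\<close> values of at least
  \<open>\<delta> ^ card T\<close> means a conditional probability of at least
  \<open>(\<delta> * q) ^ card T\<close>.\<close>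

lemma bexp_superset_ext_prob:
  assumes "finite V" "T \<subseteq> V"
  shows "bexp q V (\<lambda>U. of_bool (T \<subseteq> U) * of_bool (F (U \<union> S))) = q ^ card T * ext_prob q V F (S \<union> T)"
  unfolding bexp_superset[OF assms] ext_prob_def by (simp add: Un_ac)

text \<open>A minimiser of \<open>ext_prob q V F S / \<delta> ^ card S\<close> is compared with
  \<open>{}\<close> to bound its size, and with \<open>S \<union> T\<close> to get the extension
  property.\<close>

lemma exists_fingerprint:
  assumes "finite V" "0 \<le> q" "q \<le> 1" "0 < \<delta>" "\<delta> \<le> 1" "downset V F" "L \<subseteq> V" "F L"
  obtains S where "S \<subseteq> L" "(1 - q) ^ card V \<le> \<delta> ^ card S"
    "\<And>T. T \<subseteq> L \<Longrightarrow> \<delta> ^ card T * ext_prob q V F S \<le> ext_prob q V F (S \<union> T)"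
proof -
  let ?w = "ext_prob q V F"
  have finL: "finite L" using assms finite_subset by blast
  then obtain S where S: "is_arg_min (\<lambda>S. ?w S / \<delta> ^ card S) (\<lambda>S. S \<in> Pow L) S"
    using ex_is_arg_min_if_finite[of "Pow L" "\<lambda>S. ?w S / \<delta> ^ card S"] by auto
  then have SL: "S \<subseteq> L" and min: "\<And>T. T \<subseteq> L \<Longrightarrow> ?w S / \<delta> ^ card S \<le> ?w T / \<delta> ^ card T"
    by (auto simp: is_arg_min_linorder)
  have "?w S \<le> \<delta> ^ card S"
    using order.trans[OF min[of "{}"], of 1] ext_prob_le_1[OF assms(1,2,3), of F "{}"] assms(4)
    by (simp add: divide_le_eq)
  moreover have "F S" using assms SL downsetD by metis
  ultimately have 1: "(1 - q) ^ card V \<le> \<delta> ^ card S"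
    using ext_prob_ge[OF assms(1-3)] by force
  have 2: "\<delta> ^ card T * ?w S \<le> ?w (S \<union> T)" if "T \<subseteq> L" for T
  proof -
    have fin: "finite S" "finite T" using finL SL that finite_subset by auto
    have w0: "0 \<le> ?w S" unfolding ext_prob_def using assms by (intro bexp_nonneg) auto
    have "\<delta> ^ card T * ?w S = \<delta> ^ (card S + card T) * (?w S / \<delta> ^ card S)"
      using assms(4) by (simp add: power_add)
    \<comment> \<open>An overlap of \<open>S\<close> and \<open>T\<close> does no harm, because
      \<open>\<delta> \<le> 1\<close>.\<close>
    also have "\<dots> \<le> \<delta> ^ card (S \<union> T) * (?w S / \<delta> ^ card S)"
      using assms w0 card_Un_le by (intro mult_right_mono power_decreasing) auto
    also have "\<dots> \<le> \<delta> ^ card (S \<union> T) * (?w (S \<union> T) / \<delta> ^ card (S \<union> T))"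
      using assms that SL by (intro mult_left_mono min) auto
    finally show ?thesis using assms(4) by simp
  qed
  show thesis using that[OF SL 1 2] .
qed

section \<open>\<open>\<Lambda>\<close> as a sum over pairs of edges\<close>

text \<open>The coefficient of a pair of edges after the squared degrees in \<open>Lambda\<close>
  are expanded; it depends only on their intersection \<open>M\<close>.\<close>

definition kappa :: "real \<Rightarrow> 'a set \<Rightarrow> real" where
  "kappa p M = (\<Sum>L | L \<subseteq> M \<and> 2 \<le> card L. (1 / p) ^ card L)"

definition pair_sum :: "'a set set \<Rightarrow> real \<Rightarrow> ('a set \<Rightarrow> real) \<Rightarrow> real" where
  "pair_sum H p \<nu> = (\<Sum>E\<in>H. \<Sum>E'\<in>H. \<nu> E * \<nu> E' * kappa p (E \<inter> E'))"

lemma e_weight_induced: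
  assumes "finite H"
  shows "e_weight (induced H L) \<nu> = (\<Sum>E\<in>H. of_bool (E \<subseteq> L) * \<nu> E)"
  unfolding e_weight_def induced_def using assms
  by (intro sum.mono_neutral_cong_left) auto

text \<open>Expand the squares and exchange sums. Passing to \<open>L\<close> becomes zeroing
  weights while the index set \<open>H\<close> stays fixed, so that expectations over a random
  \<open>L\<close> can be taken term by term.\<close>

lemma Lambda_induced:
  assumes "finite H" "finite L" "0 < p"
  shows "Lambda L (induced H L) p \<nu> = pair_sum H p (\<lambda>E. of_bool (E \<subseteq> L) * \<nu> E)"
proof -
  define a where "a = (\<lambda>E. of_bool (E \<subseteq> L) * \<nu> E)"
  let ?P = "{T. T \<subseteq> L \<and> 2 \<le> card T}"
  have finP: "finite ?P" using assms(2) by auto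
  have deg: "deg_weight (induced H L) \<nu> T = (\<Sum>E\<in>H. of_bool (T \<subseteq> E) * a E)" for T
  proof -
    have "{E \<in> induced H L. T \<subseteq> E} = {E \<in> H. E \<subseteq> L \<and> T \<subseteq> E}"
      by (auto simp: induced_def)
    then show ?thesis
      unfolding deg_weight_def a_def using assms(1)
      by (auto simp: sum.inter_filter of_bool_def intro!: sum.cong)
  qed
  have pw: "p powr (- real k) = (1 / p) ^ k" for k
    using assms(3) by (simp add: powr_minus powr_realpow power_one_over inverse_eq_divide)
  have inner: "(\<Sum>T\<in>?P. of_bool (T \<subseteq> E) * a E * (of_bool (T \<subseteq> E') * a E') * (1 / p) ^ card T)
      = a E * a E' * kappa p (E \<inter> E')" for E E'
  proof (cases "E \<subseteq> L")
    case True
    have "(\<Sum>T\<in>?P. of_bool (T \<subseteq> E) * a E * (of_bool (T \<subseteq> E') * a E') * (1 / p) ^ card T)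
       = (\<Sum>T\<in>{T \<in> ?P. T \<subseteq> E \<inter> E'}. a E * a E' * (1 / p) ^ card T)"
      using finP by (subst sum.inter_filter) (auto intro!: sum.cong)
    also have "{T \<in> ?P. T \<subseteq> E \<inter> E'} = {T. T \<subseteq> E \<inter> E' \<and> 2 \<le> card T}"
      using True by auto
    finally show ?thesis by (simp add: kappa_def sum_distrib_left)
  qed (simp add: a_def)
  have "Lambda L (induced H L) p \<nu>
      = (\<Sum>T\<in>?P. \<Sum>E\<in>H. \<Sum>E'\<in>H. of_bool (T \<subseteq> E) * a E * (of_bool (T \<subseteq> E') * a E') * (1 / p) ^ card T)"
    unfolding Lambda_def deg pw power2_eq_square sum_product
    unfolding sum_distrib_right ..
  also have "\<dots> = (\<Sum>E\<in>H. \<Sum>E'\<in>H. \<Sum>T\<in>?P. of_bool (T \<subseteq> E) * a E * (of_bool (T \<subseteq> E') * a E') * (1 / p) ^ card T)"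
    by (subst sum.swap, rule sum.cong, rule refl, rule sum.swap)
  also have "\<dots> = pair_sum H p a"
    unfolding pair_sum_def inner ..
  finally show ?thesis unfolding a_def .
qed

section \<open>Estimates for \<open>kappa\<close> and \<open>pair_sum\<close>\<close>

lemma kappa_nonneg: "0 < p \<Longrightarrow> 0 \<le> kappa p M"
  unfolding kappa_def by (intro sum_nonneg) auto

lemma kappa_eq_0: "finite M \<Longrightarrow> card M < 2 \<Longrightarrow> kappa p M = 0"
  unfolding kappa_def by (intro sum.neutral) (auto dest: card_mono)

lemma kappa_ge:
  assumes "finite M" "2 \<le> card M" "0 < p"
  shows "(1 / p) ^ card M \<le> kappa p M"
proof -
  have "(\<Sum>L\<in>{M}. (1 / p) ^ card L) \<le> kappa p M"
    unfolding kappa_def using assms by (intro sum_mono2) auto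
  then show ?thesis by simp
qed

lemma sum_Pow_power_card:
  fixes x :: real
  assumes "finite M"
  shows "(\<Sum>L\<in>Pow M. x ^ card L) = (1 + x) ^ card M"
  using assms
proof (induction M rule: finite_induct)
  case (insert v M)
  have "inj_on (insert v) (Pow M)" using insert.hyps by (auto simp: inj_on_def)
  moreover have "Pow M \<inter> insert v ` Pow M = {}" using insert.hyps by auto
  moreover have "card (insert v L) = Suc (card L)" if "L \<in> Pow M" for L
    using that insert.hyps by (metis PowD card_insert_disjoint finite_subset subsetD)
  ultimately have "(\<Sum>L\<in>Pow (insert v M). x ^ card L) = (\<Sum>L\<in>Pow M. x ^ card L) + (\<Sum>L\<in>Pow M. x * x ^ card L)"
    unfolding Pow_insert using insert.hyps
    by (subst sum.union_disjoint) (simp_all add: sum.reindex)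
  then show ?case using insert by (simp add: sum_distrib_left[symmetric] algebra_simps)
qed simp

lemma kappa_le:
  assumes "finite M" "0 < p"
  shows "kappa p M \<le> (1 + 1 / p) ^ card M"
  unfolding kappa_def sum_Pow_power_card[OF assms(1), symmetric]
  using assms by (intro sum_mono2) auto

text \<open>Every \<open>L\<close> in the sum has at least two elements, so each term gains the
  square of \<open>p / l\<close>.\<close>

lemma kappa_rescale:
  assumes "0 < p" "p \<le> l"
  shows "kappa l M \<le> (p / l)\<^sup>2 * kappa p M"
  unfolding kappa_def sum_distrib_left
proof (intro sum_mono)
  fix L assume L: "L \<in> {L. L \<subseteq> M \<and> 2 \<le> card L}"
  have "(1 / l) ^ card L = (p / l) ^ card L * (1 / p) ^ card L"
    using assms by (simp add: power_divide)
  also have "\<dots> \<le> (p / l)\<^sup>2 * (1 / p) ^ card L"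
    using assms L by (intro mult_right_mono power_decreasing) auto
  finally show "(1 / l) ^ card L \<le> (p / l)\<^sup>2 * (1 / p) ^ card L" .
qed

text \<open>With \<open>m = card (E \<inter> E')\<close>, the pair survives with probability
  \<open>q ^ (2 * s - m)\<close>, and the leading term \<open>(q / p) ^ m\<close> of
  \<open>kappa (p / q)\<close> restores the missing \<open>q ^ m\<close>. The factor
  \<open>(1 + p / q) ^ s\<close> pays for the smaller subsets.\<close>

lemma kappa_thinning:
  assumes "finite E" "finite E'" "card E = s" "card E' = s" "0 < p" "0 < q"
  shows "q ^ card (E \<union> E') * kappa (p / q) (E \<inter> E') \<le> q ^ (2 * s) * (1 + p / q) ^ s * kappa p (E \<inter> E')"
proof (cases "card (E \<inter> E') < 2")
  case True
  then show ?thesis using assms by (simp add: kappa_eq_0)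
next
  case False
  let ?m = "card (E \<inter> E')"
  have m: "?m \<le> s" using assms by (metis card_mono inf_le1)
  have un: "card (E \<union> E') + ?m = 2 * s" using card_Un_Int[OF assms(1,2)] assms by simp
  have "q ^ card (E \<union> E') * kappa (p / q) (E \<inter> E') \<le> q ^ card (E \<union> E') * (1 + q / p) ^ ?m"
    using kappa_le[of "E \<inter> E'" "p / q"] assms by (intro mult_left_mono) auto
  also have "1 + q / p = q * ((1 + p / q) * (1 / p))"
    using assms by (simp add: field_simps)
  also have "(q * ((1 + p / q) * (1 / p))) ^ ?m = q ^ ?m * ((1 + p / q) ^ ?m * (1 / p) ^ ?m)"
    by (simp only: power_mult_distrib)
  also have "q ^ card (E \<union> E') * \<dots> = q ^ (2 * s) * ((1 + p / q) ^ ?m * (1 / p) ^ ?m)"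
    by (simp add: un[symmetric] power_add)
  also have "\<dots> \<le> q ^ (2 * s) * ((1 + p / q) ^ s * kappa p (E \<inter> E'))"
    using assms m False by (intro mult_left_mono mult_mono power_increasing kappa_ge) auto
  finally show ?thesis by simp
qed

lemma pair_sum_mono:
  assumes "0 < p" "\<And>E. E \<in> H \<Longrightarrow> 0 \<le> \<nu> E" "\<And>E. E \<in> H \<Longrightarrow> \<nu> E \<le> \<nu>' E"
  shows "pair_sum H p \<nu> \<le> pair_sum H p \<nu>'"
  unfolding pair_sum_def using assms
  by (intro sum_mono mult_right_mono mult_mono kappa_nonneg) (auto intro: order.trans)

lemma pair_sum_nonneg:
  assumes "0 < p" "\<And>E. E \<in> H \<Longrightarrow> 0 \<le> \<nu> E"
  shows "0 \<le> pair_sum H p \<nu>"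
  unfolding pair_sum_def using assms
  by (intro sum_nonneg mult_nonneg_nonneg kappa_nonneg) auto

lemma pair_sum_rescale:
  assumes "0 < p" "p \<le> l" "\<And>E. E \<in> H \<Longrightarrow> 0 \<le> \<nu> E"
  shows "pair_sum H l \<nu> \<le> (p / l)\<^sup>2 * pair_sum H p \<nu>"
proof -
  have "pair_sum H l \<nu> \<le> (\<Sum>E\<in>H. \<Sum>E'\<in>H. \<nu> E * \<nu> E' * ((p / l)\<^sup>2 * kappa p (E \<inter> E')))"
    unfolding pair_sum_def using assms by (intro sum_mono mult_left_mono kappa_rescale) auto
  then show ?thesis by (simp add: pair_sum_def sum_distrib_left mult_ac)
qed

section \<open>Second moments under a conditioned random set\<close>

lemma bexp_power2_ge:
  assumes "finite V" "0 \<le> q" "q \<le> 1" "\<And>U. U \<subseteq> V \<Longrightarrow> 0 \<le> g U"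
  shows "(bexp q V (\<lambda>U. f U * g U))\<^sup>2 \<le> bexp q V (\<lambda>U. (f U)\<^sup>2 * g U) * bexp q V g"
proof -
  define m where "m = bexp q V (\<lambda>U. f U * g U)"
  define w where "w = bexp q V g"
  define r where "r = bexp q V (\<lambda>U. (f U)\<^sup>2 * g U)"
  have w0: "0 \<le> w" and r0: "0 \<le> r"
    unfolding w_def r_def using assms by (auto intro!: bexp_nonneg)
  \<comment> \<open>Cauchy-Schwarz in discriminant form: this quadratic in \<open>c\<close> is the
    mean of a nonnegative function.\<close>
  have *: "0 \<le> r - 2 * c * m + c\<^sup>2 * w" for c
  proof -
    have "0 \<le> bexp q V (\<lambda>U. (f U - c)\<^sup>2 * g U)"
      using assms by (intro bexp_nonneg) auto
    also have "\<dots> = bexp q V (\<lambda>U. (f U)\<^sup>2 * g U - (2 * c) * (f U * g U) + c\<^sup>2 * g U)"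
      by (intro bexp_cong) (simp add: power2_eq_square algebra_simps)
    finally show ?thesis
      unfolding bexp_add bexp_diff bexp_cmult m_def w_def r_def .
  qed
  show ?thesis
  proof (cases "w = 0")
    case True
    have "m = 0"
    proof (rule ccontr)
      assume "m \<noteq> 0"
      \<comment> \<open>For \<open>w = 0\<close> the quadratic is linear in \<open>c\<close>, and
        this \<open>c\<close> gives it the value \<open>-1\<close>.\<close>
      then show False using *[of "(r + 1) / (2 * m)"] True r0 by simp
    qed
    then show ?thesis using w0 r0 unfolding m_def[symmetric] r_def[symmetric] w_def[symmetric] by simp
  next
    case False
    have "(m / w)\<^sup>2 * w = m\<^sup>2 / w" "2 * (m / w) * m = 2 * (m\<^sup>2 / w)"
      using False by (simp_all add: power2_eq_square)
    then have "m\<^sup>2 / w \<le> r"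
      using *[of "m / w"] by linarith
    then show ?thesis
      unfolding m_def[symmetric] r_def[symmetric] w_def[symmetric]
      using False w0 by (simp add: divide_le_eq)
  qed
qed

text \<open>The marginals force the conditioned set to span weight at least \<open>c\<close> times
  the total on average. Cauchy-Schwarz, the pointwise bound on \<open>D\<close> and Harris then
  reduce everything to the unconditioned mean of the pair sum.\<close>

lemma janson_free_weight_bound:
  assumes V: "finite V" and H: "H \<subseteq> Pow V" "\<And>E. E \<in> H \<Longrightarrow> card E = s"
    and q: "0 < q" "q \<le> 1" and p: "0 < p" and \<nu>: "\<And>E. E \<in> H \<Longrightarrow> 0 \<le> \<nu> E"
    and D: "downset V D" and w: "0 < bexp q V (\<lambda>U. of_bool (D U))" and c: "0 \<le> c"
    and marg: "\<And>E. E \<in> H \<Longrightarrow> \<nu> E \<noteq> 0 \<Longrightarrow>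
       c * bexp q V (\<lambda>U. of_bool (D U)) \<le> bexp q V (\<lambda>U. of_bool (E \<subseteq> U) * of_bool (D U))"
    and K: "0 \<le> K" "\<And>U. U \<subseteq> V \<Longrightarrow> D U \<Longrightarrow> (\<Sum>E\<in>H. of_bool (E \<subseteq> U) * \<nu> E)\<^sup>2
       \<le> K * pair_sum H (p / q) (\<lambda>E. of_bool (E \<subseteq> U) * \<nu> E)"
  shows "(c * (\<Sum>E\<in>H. \<nu> E))\<^sup>2 \<le> K * (q ^ (2 * s) * (1 + p / q) ^ s * pair_sum H p \<nu>)"
proof -
  define w where "w = bexp q V (\<lambda>U. of_bool (D U))"
  have w0: "0 < w" using w by (simp add: w_def)
  let ?e = "\<lambda>U. \<Sum>E\<in>H. of_bool (E \<subseteq> U) * \<nu> E"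
  let ?L = "\<lambda>U. pair_sum H (p / q) (\<lambda>E. of_bool (E \<subseteq> U) * \<nu> E)"
  have finE: "finite E" "E \<subseteq> V" if "E \<in> H" for E using H(1) V that by (auto intro: finite_subset)
  have thin: "bexp q V ?L \<le> q ^ (2 * s) * (1 + p / q) ^ s * pair_sum H p \<nu>"
  proof -
    have "bexp q V ?L = (\<Sum>E\<in>H. \<Sum>E'\<in>H. bexp q V (\<lambda>U. \<nu> E * \<nu> E' * kappa (p / q) (E \<inter> E') * of_bool (E \<union> E' \<subseteq> U)))"
      unfolding pair_sum_def bexp_sum
      by (intro sum.cong bexp_cong refl) auto
    also have "\<dots> = (\<Sum>E\<in>H. \<Sum>E'\<in>H. \<nu> E * \<nu> E' * (q ^ card (E \<union> E') * kappa (p / q) (E \<inter> E')))"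
    proof (intro sum.cong refl)
      fix E E' assume "E \<in> H" "E' \<in> H"
      then have "E \<union> E' \<subseteq> V" using finE by auto
      then show "bexp q V (\<lambda>U. \<nu> E * \<nu> E' * kappa (p / q) (E \<inter> E') * of_bool (E \<union> E' \<subseteq> U))
         = \<nu> E * \<nu> E' * (q ^ card (E \<union> E') * kappa (p / q) (E \<inter> E'))"
        unfolding bexp_cmult bexp_prob_superset[OF V \<open>E \<union> E' \<subseteq> V\<close>] by simp
    qed
    also have "\<dots> \<le> (\<Sum>E\<in>H. \<Sum>E'\<in>H. \<nu> E * \<nu> E' * (q ^ (2 * s) * (1 + p / q) ^ s * kappa p (E \<inter> E')))"
      using \<nu> finE H p q by (intro sum_mono mult_left_mono kappa_thinning) auto
    also have "\<dots> = q ^ (2 * s) * (1 + p / q) ^ s * pair_sum H p \<nu>"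
      unfolding pair_sum_def sum_distrib_left by (intro sum.cong refl) (simp only: mult_ac)
    finally show ?thesis .
  qed
  have "(c * w * (\<Sum>E\<in>H. \<nu> E)) = (\<Sum>E\<in>H. \<nu> E * (c * w))"
    by (simp add: sum_distrib_left mult_ac)
  also have "\<dots> \<le> (\<Sum>E\<in>H. \<nu> E * bexp q V (\<lambda>U. of_bool (E \<subseteq> U) * of_bool (D U)))"
  proof (intro sum_mono)
    fix E assume "E \<in> H"
    then show "\<nu> E * (c * w) \<le> \<nu> E * bexp q V (\<lambda>U. of_bool (E \<subseteq> U) * of_bool (D U))"
      using \<nu> marg unfolding w_def by (cases "\<nu> E = 0") (auto intro!: mult_left_mono)
  qed
  also have "\<dots> = bexp q V (\<lambda>U. ?e U * of_bool (D U))"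
    unfolding sum_distrib_right bexp_sum bexp_cmult[symmetric]
    by (intro sum.cong bexp_cong refl) simp
  finally have "(c * w * (\<Sum>E\<in>H. \<nu> E))\<^sup>2 \<le> (bexp q V (\<lambda>U. ?e U * of_bool (D U)))\<^sup>2"
    using c w0 \<nu> by (intro power_mono mult_nonneg_nonneg sum_nonneg) auto
  also have "\<dots> \<le> bexp q V (\<lambda>U. (?e U)\<^sup>2 * of_bool (D U)) * w"
    unfolding w_def using V q by (intro bexp_power2_ge) auto
  also have "\<dots> \<le> bexp q V (\<lambda>U. K * (?L U * of_bool (D U))) * w"
    using q w0 K by (intro mult_right_mono bexp_mono) auto
  also have "\<dots> = K * bexp q V (\<lambda>U. ?L U * of_bool (D U)) * w"
    by (simp add: bexp_cmult)
  \<comment> \<open>The pair sum increases with \<open>U\<close> while the indicator of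
    \<open>D\<close> decreases, so conditioning on \<open>D\<close> can only lower its mean.\<close>
  also have "\<dots> \<le> K * (bexp q V ?L * w) * w"
  proof (intro mult_right_mono mult_left_mono)
    show "bexp q V (\<lambda>U. ?L U * of_bool (D U)) \<le> bexp q V ?L * w"
      unfolding w_def
    proof (rule bexp_harris)
      fix A B assume "A \<subseteq> B" "B \<subseteq> V"
      then show "?L A \<le> ?L B"
        using p q \<nu> by (intro pair_sum_mono) auto
      show "of_bool (D B) \<le> (of_bool (D A) :: real)"
        using D \<open>A \<subseteq> B\<close> \<open>B \<subseteq> V\<close> by (auto simp: downset_def)
    qed (use V q in auto)
  qed (use K w0 in auto)
  also have "\<dots> \<le> K * (q ^ (2 * s) * (1 + p / q) ^ s * pair_sum H p \<nu> * w) * w"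
    using K w0 by (intro mult_right_mono mult_left_mono thin) auto
  finally have "(c * w * (\<Sum>E\<in>H. \<nu> E))\<^sup>2
      \<le> K * (q ^ (2 * s) * (1 + p / q) ^ s * pair_sum H p \<nu> * w) * w" .
  then have "w\<^sup>2 * (c * (\<Sum>E\<in>H. \<nu> E))\<^sup>2 \<le> w\<^sup>2 * (K * (q ^ (2 * s) * (1 + p / q) ^ s * pair_sum H p \<nu>))"
    by (simp add: power_mult_distrib power2_eq_square mult_ac)
  then show ?thesis
    using w0 by (simp add: mult_le_cancel_left_pos)
qed

section \<open>Edges spanned by a conditioned random set\<close>

lemma sum_power_minus_one_le:
  fixes x :: real
  assumes "2 \<le> x"
  shows "(\<Sum>j<Suc m. x ^ j - 1) \<le> 2 * (x ^ m - 1)"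
proof (induction m)
  case (Suc m)
  have "2 * x ^ m \<le> x ^ Suc m" using assms by simp
  moreover have "1 \<le> x ^ m" using assms by (intro one_le_power) simp
  ultimately have "2 * (x ^ m - 1) + (x ^ Suc m - 1) \<le> 2 * (x ^ Suc m - 1)" by argo
  then show ?case
    using Suc.IH unfolding sum.lessThan_Suc[of _ "Suc m"] by argo
qed simp

text \<open>At each \<open>i\<close> with \<open>f i = g i\<close> the common part of the two
  prefixes gains a new vertex. Its sizes at these \<open>i\<close> are thus distinct and below
  \<open>card M\<close>, and a geometric sum bounds the total.\<close>

lemma sum_matching_prefixes_le:
  fixes f g :: "nat \<Rightarrow> 'a"
  assumes inj: "inj_on f {..<s}" "inj_on g {..<s}" and l: "0 < l" "l \<le> 1 / 2"
  shows "(\<Sum>i<s. of_bool (f i = g i) * ((1 / l) ^ card (f ` {..<i} \<inter> g ` {..<i}) - 1))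
    \<le> 2 * l * kappa l (f ` {..<s} \<inter> g ` {..<s})"
proof -
  define I where "I = {i. i < s \<and> f i = g i}"
  define m where "m = (\<lambda>i. card (f ` {..<i} \<inter> g ` {..<i}))"
  define M where "M = f ` {..<s} \<inter> g ` {..<s}"
  define F where "F = (\<lambda>j. (1 / l) ^ j - 1)"
  have F0: "0 \<le> F j" for j using l by (simp add: F_def)
  have less: "card (f ` {..<i} \<inter> g ` {..<i}) < card N"
    if "i \<in> I" "f ` {..<i} \<inter> g ` {..<i} \<subseteq> N" "f i \<in> N" "finite N" for i N
  proof (rule psubset_card_mono[OF that(4)])
    have "f i \<noteq> f j" if "j < i" for j
      using inj_on_eq_iff[OF inj(1), of i j] \<open>i \<in> I\<close> that by (simp add: I_def)
    then have "f i \<notin> f ` {..<i}" by auto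
    then show "f ` {..<i} \<inter> g ` {..<i} \<subset> N" using that by blast
  qed
  have I: "i < s" "f i = g i" if "i \<in> I" for i using that by (auto simp: I_def)
  have lt: "m i < card M" if "i \<in> I" for i
    unfolding m_def
  proof (rule less[OF that])
    show "f ` {..<i} \<inter> g ` {..<i} \<subseteq> M" using I(1)[OF that] by (auto simp: M_def)
    have "f i \<in> f ` {..<s}" "g i \<in> g ` {..<s}" using I(1)[OF that] by auto
    then show "f i \<in> M" using I(2)[OF that] by (simp add: M_def)
  qed (simp add: M_def)
  have sm: "m i < m j" if "i \<in> I" "i < j" for i j
    unfolding m_def
  proof (rule less[OF that(1)])
    show "f ` {..<i} \<inter> g ` {..<i} \<subseteq> f ` {..<j} \<inter> g ` {..<j}" using that(2) by auto
    have "f i \<in> f ` {..<j}" "g i \<in> g ` {..<j}" using that(2) by auto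
    then show "f i \<in> f ` {..<j} \<inter> g ` {..<j}" using I(2)[OF that(1)] by simp
  qed simp
  have injm: "inj_on m I"
    by (rule inj_onI) (metis sm less_irrefl linorder_neqE_nat)
  have "(\<Sum>i<s. of_bool (f i = g i) * F (m i)) = (\<Sum>i\<in>I. F (m i))"
    unfolding I_def by (rule sum.mono_neutral_cong_right) auto
  also have "\<dots> = (\<Sum>j\<in>m ` I. F j)"
    by (simp add: sum.reindex[OF injm])
  also have "\<dots> \<le> (\<Sum>j<card M. F j)"
    using lt F0 by (intro sum_mono2) auto
  also have "\<dots> \<le> 2 * l * kappa l M"
  proof (cases "card M < 2")
    \<comment> \<open>Only \<open>j = 0\<close> can occur, where \<open>F j = 0\<close>; this
      matches the vanishing of \<open>kappa\<close> on sets with fewer than two elements.\<close>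
    case True
    then have "card M = 0 \<or> card M = 1" by auto
    then have "(\<Sum>j<card M. F j) = 0" by (auto simp: F_def)
    then show ?thesis using l kappa_nonneg[of l M] by simp
  next
    case False
    then obtain k where k: "card M = Suc k" by (cases "card M") auto
    have "(\<Sum>j<card M. F j) \<le> 2 * ((1 / l) ^ k - 1)"
      unfolding k F_def using l by (intro sum_power_minus_one_le) (simp add: field_simps)
    \<comment> \<open>The largest exponent is \<open>card M - 1\<close>, which is the source of the
      extra factor \<open>l\<close>.\<close>
    also have "\<dots> \<le> 2 * l * (1 / l) ^ card M"
      using l by (simp add: k)
    also have "\<dots> \<le> 2 * l * kappa l M"
      using l False by (intro mult_left_mono kappa_ge) (auto simp: M_def)
    finally show ?thesis .
  qed
  finally show ?thesis by (simp add: F_def m_def M_def)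
qed

text \<open>Deleting \<open>v\<close> from a set keeps it in \<open>D\<close> and leaves
  \<open>h\<close> unchanged, so \<open>v\<close> is negatively correlated with \<open>D\<close>
  under the weight \<open>h\<close>.\<close>

lemma bexp_member_downset_le:
  assumes "finite V" "v \<in> V" "0 \<le> q" "q \<le> 1" "downset V D"
    and "\<And>U. U \<subseteq> V \<Longrightarrow> 0 \<le> h U" "\<And>U. U \<subseteq> V \<Longrightarrow> h (insert v U) = h U"
  shows "bexp q V (\<lambda>U. of_bool (v \<in> U) * (h U * of_bool (D U))) \<le> q * bexp q V (\<lambda>U. h U * of_bool (D U))"
  unfolding bexp_member[OF assms(1,2)]
proof (intro mult_left_mono bexp_mono)
  fix U assume U: "U \<subseteq> V"
  then have "D (insert v U) \<Longrightarrow> D U"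
    using assms by (auto intro: downsetD)
  then show "h (insert v U) * of_bool (D (insert v U)) \<le> h U * of_bool (D U)"
    using assms(6,7)[OF U] by auto
qed (use assms in auto)

text \<open>The parabola \<open>(y + t)^2 / (4 * t)\<close> lies above \<open>max 0 y\<close>,
  touching the line \<open>y\<close> at \<open>t\<close>. Since \<open>G U - g\<close> has mean
  zero, averaging leaves the variance plus \<open>t^2\<close>.\<close>

lemma bexp_pos_part_le:
  assumes "finite V" "0 \<le> q" "q \<le> 1" "0 < t" "bexp q V G = g"
  shows "bexp q V (\<lambda>U. max 0 (G U - g)) \<le> (bexp q V (\<lambda>U. (G U)\<^sup>2) - g\<^sup>2 + t\<^sup>2) / (4 * t)"
proof -
  have pos: "max 0 y \<le> (y + t)\<^sup>2 / (4 * t)" for y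
  proof -
    have "4 * t * y \<le> (y + t)\<^sup>2"
      using zero_le_power2[of "y - t"] by (simp add: power2_eq_square algebra_simps)
    then have "y \<le> (y + t)\<^sup>2 / (4 * t)" using assms(4) by (simp add: le_divide_eq mult.commute)
    then show ?thesis using assms(4) by simp
  qed
  have sq: "(y - g + t)\<^sup>2 = y\<^sup>2 + (2 * (t - g)) * y + (t - g)\<^sup>2" for y
    by (simp add: power2_eq_square algebra_simps)
  have "bexp q V (\<lambda>U. max 0 (G U - g)) \<le> bexp q V (\<lambda>U. (G U - g + t)\<^sup>2 / (4 * t))"
    using assms pos by (intro bexp_mono) auto
  also have "\<dots> = bexp q V (\<lambda>U. (1 / (4 * t)) * (((G U)\<^sup>2 + (2 * (t - g)) * G U) + (t - g)\<^sup>2))"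
    by (intro bexp_cong) (simp add: sq)
  also have "\<dots> = (1 / (4 * t)) * (bexp q V (\<lambda>U. (G U)\<^sup>2) + (2 * (t - g)) * g + (t - g)\<^sup>2)"
    unfolding bexp_cmult bexp_add bexp_const[OF assms(1)] assms(5) ..
  also have "bexp q V (\<lambda>U. (G U)\<^sup>2) + (2 * (t - g)) * g + (t - g)\<^sup>2
      = bexp q V (\<lambda>U. (G U)\<^sup>2) - g\<^sup>2 + t\<^sup>2"
    using sq[of g] by (simp add: algebra_simps)
  also have "(1 / (4 * t)) * \<dots> = \<dots> / (4 * t)" by simp
  finally show ?thesis .
qed

text \<open>The Harris inequality replaces the independence of \<open>v\<close> and \<open>G\<close>: it bounds the upper deviations of
  \<open>G\<close> under the conditioned measure, and the lower ones then follow from the mean.\<close>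

lemma bexp_extend_by_vertex:
  assumes V: "finite V" "v \<in> V" and l: "0 < l" "l \<le> 1" and D: "downset V D"
    and G: "\<And>A B. A \<subseteq> B \<Longrightarrow> B \<subseteq> V \<Longrightarrow> G A \<le> G B" "\<And>U. U \<subseteq> V \<Longrightarrow> G (insert v U) = G U"
    and g: "0 \<le> g"
    and marg: "g \<noteq> 0 \<Longrightarrow> (1 - \<epsilon>) * l * bexp l V (\<lambda>U. of_bool (D U))
        \<le> bexp l V (\<lambda>U. of_bool (v \<in> U) * of_bool (D U))"
  shows "bexp l V (\<lambda>U. G U * of_bool (D U))
      - bexp l V (\<lambda>U. of_bool (D U)) * (\<epsilon> * g + bexp l V (\<lambda>U. max 0 (G U - g)))
      \<le> bexp l V (\<lambda>U. of_bool (v \<in> U) * (G U * of_bool (D U))) / l"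
proof -
  define w where "w = bexp l V (\<lambda>U. of_bool (D U))"
  define P where "P = bexp l V (\<lambda>U. max 0 (G U - g))"
  define d where "d = (\<lambda>U. of_bool (D U) :: real)"
  define h where "h = (\<lambda>U. max 0 (g - G U))"
  have "g * ((1 - \<epsilon>) * l * w) \<le> g * bexp l V (\<lambda>U. of_bool (v \<in> U) * d U)"
    using marg g by (cases "g = 0") (auto simp: w_def d_def intro!: mult_left_mono)
  moreover have "bexp l V (\<lambda>U. of_bool (v \<in> U) * (h U * d U)) \<le> l * bexp l V (\<lambda>U. h U * d U)"
    unfolding d_def using V l D G by (intro bexp_member_downset_le) (auto simp: h_def)
  \<comment> \<open>The lower deviation is \<open>g - G\<close> plus the upper deviation, and the
    latter is increasing, as Harris requires.\<close>
  moreover have "bexp l V (\<lambda>U. h U * d U)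
      = bexp l V (\<lambda>U. g * d U - G U * d U + max 0 (G U - g) * d U)"
    by (intro bexp_cong) (auto simp: h_def max_def algebra_simps)
  then have "bexp l V (\<lambda>U. h U * d U)
      = g * w - bexp l V (\<lambda>U. G U * d U) + bexp l V (\<lambda>U. max 0 (G U - g) * d U)"
    unfolding bexp_add bexp_diff bexp_cmult by (simp add: w_def d_def)
  moreover have "bexp l V (\<lambda>U. max 0 (G U - g) * d U) \<le> P * w"
    unfolding P_def w_def d_def
  proof (rule bexp_harris)
    fix A B assume AB: "A \<subseteq> B" "B \<subseteq> V"
    then show "max 0 (G A - g) \<le> max 0 (G B - g)" using G(1)[OF AB] by linarith
    show "of_bool (D B) \<le> (of_bool (D A) :: real)" using D AB by (auto simp: downset_def)
  qed (use V l in auto)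
  moreover have "bexp l V (\<lambda>U. g * (of_bool (v \<in> U) * d U) - of_bool (v \<in> U) * (h U * d U))
      \<le> bexp l V (\<lambda>U. of_bool (v \<in> U) * (G U * d U))"
    using l by (intro bexp_mono) (auto simp: h_def d_def max_def)
  then have "g * bexp l V (\<lambda>U. of_bool (v \<in> U) * d U) - bexp l V (\<lambda>U. of_bool (v \<in> U) * (h U * d U))
      \<le> bexp l V (\<lambda>U. of_bool (v \<in> U) * (G U * d U))"
    unfolding bexp_diff bexp_cmult .
  ultimately have "g * ((1 - \<epsilon>) * l * w) - l * (g * w - bexp l V (\<lambda>U. G U * d U) + P * w)
      \<le> bexp l V (\<lambda>U. of_bool (v \<in> U) * (G U * d U))"
    using mult_left_mono[of "bexp l V (\<lambda>U. h U * d U)"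
        "g * w - bexp l V (\<lambda>U. G U * d U) + P * w" l] l by linarith
  moreover have "g * ((1 - \<epsilon>) * l * w) - l * (g * w - bexp l V (\<lambda>U. G U * d U) + P * w)
      = l * (bexp l V (\<lambda>U. G U * d U) - w * (\<epsilon> * g + P))"
    by (simp add: algebra_simps)
  ultimately have "bexp l V (\<lambda>U. G U * d U) - w * (\<epsilon> * g + P)
      \<le> bexp l V (\<lambda>U. of_bool (v \<in> U) * (G U * d U)) / l"
    using l by (simp only: le_divide_eq mult.commute) simp
  then show ?thesis by (simp only: w_def P_def d_def)
qed

text \<open>Each edge is enumerated and its first \<open>i\<close> vertices are tracked. The
  normalised mass \<open>Q i\<close> starts at the full weight times the probability of
  \<open>D\<close>; each added vertex costs an \<open>\<epsilon>\<close> fraction of the weight and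
  variance terms, whose total is a pair sum.\<close>

lemma edge_mass_ge:
  assumes V: "finite V" and H: "H \<subseteq> Pow V" "\<And>E. E \<in> H \<Longrightarrow> card E = s"
    and l: "0 < l" "l \<le> 1 / 2" and \<nu>: "\<And>E. E \<in> H \<Longrightarrow> 0 \<le> \<nu> E"
    and D: "downset V D" and t: "0 < t"
    and marg: "\<And>E v. E \<in> H \<Longrightarrow> \<nu> E \<noteq> 0 \<Longrightarrow> v \<in> E \<Longrightarrow>
       (1 - \<epsilon>) * l * bexp l V (\<lambda>U. of_bool (D U)) \<le> bexp l V (\<lambda>U. of_bool (v \<in> U) * of_bool (D U))"
  shows "bexp l V (\<lambda>U. of_bool (D U)) * ((1 - real s * \<epsilon>) * (\<Sum>E\<in>H. \<nu> E)
        - (2 * l * pair_sum H l \<nu> + real (card V) * real s * t\<^sup>2) / (4 * t))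
      \<le> (\<Sum>E\<in>H. \<nu> E * (bexp l V (\<lambda>U. of_bool (E \<subseteq> U) * of_bool (D U)) / l ^ s))"
proof -
  define w where "w = bexp l V (\<lambda>U. of_bool (D U))"
  define e where "e = (\<Sum>E\<in>H. \<nu> E)"
  have finH: "finite H" using H(1) V by (simp add: finite_subset)
  have finE: "finite E" "E \<subseteq> V" if "E \<in> H" for E using H(1) V that by (auto intro: finite_subset)
  have w0: "0 \<le> w" unfolding w_def using l by (intro bexp_nonneg) auto
  have "\<exists>f. bij_betw f {..<s} E" if "E \<in> H" for E
    using ex_bij_betw_nat_finite[OF finE(1)[OF that]] H(2)[OF that] by (simp add: atLeast0LessThan)
  then obtain en where en: "\<And>E. E \<in> H \<Longrightarrow> bij_betw (en E) {..<s} E" by metis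
  have inj: "inj_on (en E) {..<s}" and img: "en E ` {..<s} = E" if "E \<in> H" for E
    using en[OF that] by (auto simp: bij_betw_def)
  define ini where "ini = (\<lambda>i E. en E ` {..<i})"
  have ini_sub: "ini i E \<subseteq> V" and ini_card: "card (ini i E) = i" and ini_fin: "finite (ini i E)"
    if "E \<in> H" "i \<le> s" for i E
  proof -
    have "ini i E \<subseteq> E" using img[OF that(1)] that(2) by (auto simp: ini_def)
    then show "ini i E \<subseteq> V" using finE that by blast
    show "card (ini i E) = i"
      unfolding ini_def using inj[OF that(1)] that(2)
      by (subst card_image) (auto intro: inj_on_subset)
    show "finite (ini i E)" by (simp add: ini_def)
  qed
  define A where "A = (\<lambda>i v. {E \<in> H. en E i = v})"
  have finA: "finite (A i v)" for i v using finH by (simp add: A_def)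
  \<comment> \<open>Edges are grouped by their next vertex \<open>v\<close>; dividing by
    \<open>l ^ i\<close> gives \<open>G i v\<close> the mean \<open>g i v\<close>.\<close>
  define G where "G = (\<lambda>i v U. \<Sum>E\<in>A i v. \<nu> E * (of_bool (ini i E \<subseteq> U) / l ^ i))"
  define g where "g = (\<lambda>i v. \<Sum>E\<in>A i v. \<nu> E)"
  define Var where "Var = (\<lambda>i v. bexp l V (\<lambda>U. (G i v U)\<^sup>2) - (g i v)\<^sup>2)"
  define Q where "Q = (\<lambda>i. \<Sum>E\<in>H. \<nu> E * (bexp l V (\<lambda>U. of_bool (ini i E \<subseteq> U) * of_bool (D U)) / l ^ i))"
  have split: "(\<Sum>E\<in>H. F E) = (\<Sum>v\<in>V. \<Sum>E\<in>A i v. F E)" if "i < s" for i and F :: "'a set \<Rightarrow> real"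
    unfolding A_def
  proof (rule sum.group[symmetric])
    show "(\<lambda>E. en E i) ` H \<subseteq> V"
      using that img finE by (fastforce simp: image_subset_iff)
  qed (use finH V in auto)
  have meanG: "bexp l V (G i v) = g i v" if "i < s" for i v
  proof -
    have "bexp l V (G i v) = (\<Sum>E\<in>A i v. \<nu> E / l ^ i * bexp l V (\<lambda>U. of_bool (ini i E \<subseteq> U)))"
      unfolding G_def bexp_sum bexp_cmult[symmetric] by (intro sum.cong bexp_cong refl) simp
    also have "\<dots> = g i v"
      unfolding g_def
    proof (intro sum.cong refl)
      fix E assume "E \<in> A i v"
      then have "E \<in> H" by (simp add: A_def)
      then show "\<nu> E / l ^ i * bexp l V (\<lambda>U. of_bool (ini i E \<subseteq> U)) = \<nu> E"
        using that l by (simp add: bexp_prob_superset[OF V ini_sub] ini_card)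
    qed
    finally show ?thesis .
  qed
  \<comment> \<open>Two prefixes of size \<open>i\<close> are both present with probability
    \<open>l ^ (2 * i)\<close> divided by \<open>l\<close> to the size of their overlap, so disjoint
    prefixes contribute nothing.\<close>
  have Var_eq: "Var i v = (\<Sum>E\<in>A i v. \<Sum>E'\<in>A i v. \<nu> E * \<nu> E' * ((1 / l) ^ card (ini i E \<inter> ini i E') - 1))"
    if i: "i < s" for i v
  proof -
    have "bexp l V (\<lambda>U. (G i v U)\<^sup>2) = (\<Sum>E\<in>A i v. \<Sum>E'\<in>A i v.
        bexp l V (\<lambda>U. \<nu> E * \<nu> E' / l ^ (2 * i) * of_bool (ini i E \<union> ini i E' \<subseteq> U)))"
      unfolding G_def power2_eq_square sum_product bexp_sum
      by (intro sum.cong bexp_cong refl) (auto simp: mult_2 power_add)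
    also have "\<dots> = (\<Sum>E\<in>A i v. \<Sum>E'\<in>A i v. \<nu> E * \<nu> E' * (1 / l) ^ card (ini i E \<inter> ini i E'))"
    proof (intro sum.cong refl)
      fix E E' assume "E \<in> A i v" "E' \<in> A i v"
      then have E: "E \<in> H" "E' \<in> H" by (auto simp: A_def)
      have "card (ini i E \<union> ini i E') + card (ini i E \<inter> ini i E') = 2 * i"
        using card_Un_Int[OF ini_fin ini_fin, of E i E' i] E i by (simp add: ini_card)
      then have "l ^ (2 * i) = l ^ card (ini i E \<union> ini i E') * l ^ card (ini i E \<inter> ini i E')"
        by (metis power_add)
      then show "bexp l V (\<lambda>U. \<nu> E * \<nu> E' / l ^ (2 * i) * of_bool (ini i E \<union> ini i E' \<subseteq> U))
          = \<nu> E * \<nu> E' * (1 / l) ^ card (ini i E \<inter> ini i E')"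
        unfolding bexp_cmult
        using l E i by (subst bexp_prob_superset[OF V]) (auto simp: ini_sub power_one_over divide_simps)
    qed
    finally show ?thesis
      unfolding Var_def g_def power2_eq_square sum_product
      by (simp add: sum_subtractf[symmetric] algebra_simps)
  qed
  have sumVar: "(\<Sum>i<s. \<Sum>v\<in>V. Var i v) \<le> 2 * l * pair_sum H l \<nu>"
  proof -
    \<comment> \<open>Summing over \<open>v\<close> leaves exactly the pairs of edges that agree at
      position \<open>i\<close>.\<close>
    have "(\<Sum>v\<in>V. Var i v) = (\<Sum>E\<in>H. \<Sum>E'\<in>H. \<nu> E * \<nu> E' *
        (of_bool (en E i = en E' i) * ((1 / l) ^ card (ini i E \<inter> ini i E') - 1)))" if i: "i < s" for i
    proof -
      have "(\<Sum>v\<in>V. Var i v) = (\<Sum>v\<in>V. \<Sum>E\<in>A i v. \<Sum>E'\<in>A i (en E i).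
          \<nu> E * \<nu> E' * ((1 / l) ^ card (ini i E \<inter> ini i E') - 1))"
        using i by (intro sum.cong refl) (auto simp: Var_eq A_def intro!: sum.cong)
      also have "\<dots> = (\<Sum>E\<in>H. \<Sum>E'\<in>A i (en E i).
          \<nu> E * \<nu> E' * ((1 / l) ^ card (ini i E \<inter> ini i E') - 1))"
        by (rule split[OF i, symmetric])
      also have "\<dots> = (\<Sum>E\<in>H. \<Sum>E'\<in>H. \<nu> E * \<nu> E' *
        (of_bool (en E i = en E' i) * ((1 / l) ^ card (ini i E \<inter> ini i E') - 1)))"
        unfolding A_def using finH
        by (intro sum.cong refl sum.mono_neutral_cong_left) auto
      finally show ?thesis .
    qed
    then have "(\<Sum>i<s. \<Sum>v\<in>V. Var i v) = (\<Sum>i<s. \<Sum>E\<in>H. \<Sum>E'\<in>H. \<nu> E * \<nu> E' *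
        (of_bool (en E i = en E' i) * ((1 / l) ^ card (ini i E \<inter> ini i E') - 1)))"
      by simp
    also have "\<dots> = (\<Sum>E\<in>H. \<Sum>E'\<in>H. \<nu> E * \<nu> E' * (\<Sum>i<s.
        of_bool (en E i = en E' i) * ((1 / l) ^ card (ini i E \<inter> ini i E') - 1)))"
      unfolding sum_distrib_left
      by (subst sum.swap, rule sum.cong, rule refl, rule sum.swap)
    also have "\<dots> \<le> (\<Sum>E\<in>H. \<Sum>E'\<in>H. \<nu> E * \<nu> E' * (2 * l * kappa l (E \<inter> E')))"
    proof (intro sum_mono mult_left_mono)
      fix E E' assume E: "E \<in> H" "E' \<in> H"
      show "(\<Sum>i<s. of_bool (en E i = en E' i) * ((1 / l) ^ card (ini i E \<inter> ini i E') - 1))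
          \<le> 2 * l * kappa l (E \<inter> E')"
        using sum_matching_prefixes_le[OF inj[OF E(1)] inj[OF E(2)] l]
        unfolding ini_def img[OF E(1)] img[OF E(2)] .
      show "0 \<le> \<nu> E * \<nu> E'" using \<nu> E by simp
    qed
    also have "\<dots> = 2 * l * pair_sum H l \<nu>"
      by (simp add: pair_sum_def sum_distrib_left mult_ac)
    finally show ?thesis .
  qed
  have step: "Q i - w * (\<epsilon> * e + (\<Sum>v\<in>V. (Var i v + t\<^sup>2) / (4 * t))) \<le> Q (Suc i)" if i: "i < s" for i
  proof -
    have one: "bexp l V (\<lambda>U. G i v U * of_bool (D U)) - w * (\<epsilon> * g i v + (Var i v + t\<^sup>2) / (4 * t))
        \<le> bexp l V (\<lambda>U. of_bool (v \<in> U) * (G i v U * of_bool (D U))) / l" if v: "v \<in> V" for v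
    proof -
      have "bexp l V (\<lambda>U. max 0 (G i v U - g i v)) \<le> (Var i v + t\<^sup>2) / (4 * t)"
        unfolding Var_def using V l t meanG[OF i] by (intro bexp_pos_part_le) auto
      then have "w * (\<epsilon> * g i v + bexp l V (\<lambda>U. max 0 (G i v U - g i v)))
          \<le> w * (\<epsilon> * g i v + (Var i v + t\<^sup>2) / (4 * t))"
        using w0 by (intro mult_left_mono) auto
      moreover have "bexp l V (\<lambda>U. G i v U * of_bool (D U))
         - w * (\<epsilon> * g i v + bexp l V (\<lambda>U. max 0 (G i v U - g i v)))
        \<le> bexp l V (\<lambda>U. of_bool (v \<in> U) * (G i v U * of_bool (D U))) / l"
        unfolding w_def
      proof (rule bexp_extend_by_vertex[OF V v l(1) _ D])
        show "G i v B \<le> G i v C" if "B \<subseteq> C" "C \<subseteq> V" for B C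
          unfolding G_def using that \<nu> l
          by (intro sum_mono mult_left_mono divide_right_mono) (auto simp: A_def)
        show "G i v (insert v U) = G i v U" if "U \<subseteq> V" for U
          unfolding G_def
        proof (intro sum.cong refl)
          fix E assume E: "E \<in> A i v"
          have "en E i \<noteq> en E j" if "j < i" for j
            using inj_on_eq_iff[OF inj, of E i j] E i that by (simp add: A_def)
          then have "v \<notin> ini i E"
            using E by (auto simp: A_def ini_def)
          then show "\<nu> E * (of_bool (ini i E \<subseteq> insert v U) / l ^ i) = \<nu> E * (of_bool (ini i E \<subseteq> U) / l ^ i)"
            by (simp add: subset_insert)
        qed
        show "0 \<le> g i v" unfolding g_def using \<nu> by (intro sum_nonneg) (auto simp: A_def)
        assume "g i v \<noteq> 0"
        \<comment> \<open>A nonzero \<open>g i v\<close> supplies an edge of nonzero weight through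
          \<open>v\<close>, to which the marginal hypothesis applies.\<close>
        then obtain E where "E \<in> A i v" "\<nu> E \<noteq> 0" unfolding g_def by (meson sum.neutral)
        then show "(1 - \<epsilon>) * l * bexp l V (\<lambda>U. of_bool (D U))
            \<le> bexp l V (\<lambda>U. of_bool (v \<in> U) * of_bool (D U))"
          using i img by (intro marg[of E]) (auto simp: A_def)
      qed (use l in auto)
      ultimately show ?thesis by linarith
    qed
    have "Q i - w * (\<epsilon> * e + (\<Sum>v\<in>V. (Var i v + t\<^sup>2) / (4 * t)))
      = (\<Sum>v\<in>V. bexp l V (\<lambda>U. G i v U * of_bool (D U)) - w * (\<epsilon> * g i v + (Var i v + t\<^sup>2) / (4 * t)))"
    proof -
      have "bexp l V (\<lambda>U. G i v U * of_bool (D U))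
          = (\<Sum>E\<in>A i v. \<nu> E * (bexp l V (\<lambda>U. of_bool (ini i E \<subseteq> U) * of_bool (D U)) / l ^ i))" for v
      proof -
        have "bexp l V (\<lambda>U. G i v U * of_bool (D U))
          = (\<Sum>E\<in>A i v. bexp l V (\<lambda>U. \<nu> E / l ^ i * (of_bool (ini i E \<subseteq> U) * of_bool (D U))))"
          unfolding G_def sum_distrib_right bexp_sum by (intro sum.cong bexp_cong refl) simp
        then show ?thesis unfolding bexp_cmult by simp
      qed
      then have "Q i = (\<Sum>v\<in>V. bexp l V (\<lambda>U. G i v U * of_bool (D U)))"
        unfolding Q_def split[OF i] by simp
      moreover have "e = (\<Sum>v\<in>V. g i v)" unfolding e_def g_def by (rule split[OF i])
      ultimately show ?thesis
        by (simp add: sum_subtractf sum.distrib sum_distrib_left distrib_left)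
    qed
    also have "\<dots> \<le> (\<Sum>v\<in>V. bexp l V (\<lambda>U. of_bool (v \<in> U) * (G i v U * of_bool (D U))) / l)"
      by (intro sum_mono one)
    also have "\<dots> = Q (Suc i)"
      unfolding Q_def split[OF i]
    proof (intro sum.cong refl)
      fix v assume "v \<in> V"
      have "bexp l V (\<lambda>U. of_bool (v \<in> U) * (G i v U * of_bool (D U))) / l
        = bexp l V (\<lambda>U. inverse l * (of_bool (v \<in> U) * (G i v U * of_bool (D U))))"
        unfolding bexp_cmult by (simp add: divide_inverse)
      also have "\<dots> = bexp l V (\<lambda>U. \<Sum>E\<in>A i v. \<nu> E * inverse (l ^ Suc i) * (of_bool (ini (Suc i) E \<subseteq> U) * of_bool (D U)))"
      proof (intro bexp_cong)
        fix U assume "U \<subseteq> V"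
        show "inverse l * (of_bool (v \<in> U) * (G i v U * of_bool (D U)))
         = (\<Sum>E\<in>A i v. \<nu> E * inverse (l ^ Suc i) * (of_bool (ini (Suc i) E \<subseteq> U) * of_bool (D U)))"
          unfolding G_def sum_distrib_right sum_distrib_left
        proof (intro sum.cong refl)
          fix E assume "E \<in> A i v"
          then have "ini (Suc i) E = insert v (ini i E)"
            by (auto simp: ini_def A_def lessThan_Suc)
          then show "inverse l * (of_bool (v \<in> U) * (\<nu> E * (of_bool (ini i E \<subseteq> U) / l ^ i) * of_bool (D U)))
            = \<nu> E * inverse (l ^ Suc i) * (of_bool (ini (Suc i) E \<subseteq> U) * of_bool (D U))"
            by (auto simp: divide_inverse)
        qed
      qed
      also have "\<dots> = (\<Sum>E\<in>A i v. \<nu> E * (bexp l V (\<lambda>U. of_bool (ini (Suc i) E \<subseteq> U) * of_bool (D U)) / l ^ Suc i))"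
        unfolding bexp_sum bexp_cmult by (simp add: divide_inverse mult_ac)
      finally show "bexp l V (\<lambda>U. of_bool (v \<in> U) * (G i v U * of_bool (D U))) / l
        = (\<Sum>E\<in>A i v. \<nu> E * (bexp l V (\<lambda>U. of_bool (ini (Suc i) E \<subseteq> U) * of_bool (D U)) / l ^ Suc i))" .
    qed
    finally show ?thesis .
  qed
  have iter: "Q 0 - w * (real k * \<epsilon> * e + (\<Sum>i<k. \<Sum>v\<in>V. (Var i v + t\<^sup>2) / (4 * t))) \<le> Q k" if "k \<le> s" for k
    using that
  proof (induction k)
    case (Suc k)
    then show ?case using step[of k] by (simp add: algebra_simps)
  qed simp
  have Q0: "Q 0 = e * w" by (simp add: Q_def ini_def e_def w_def sum_distrib_right)
  have "(\<Sum>i<s. \<Sum>v\<in>V. (Var i v + t\<^sup>2) / (4 * t))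
      = ((\<Sum>i<s. \<Sum>v\<in>V. Var i v) + real (card V) * real s * t\<^sup>2) / (4 * t)"
    by (simp add: sum_divide_distrib[symmetric] sum.distrib)
  also have "\<dots> \<le> (2 * l * pair_sum H l \<nu> + real (card V) * real s * t\<^sup>2) / (4 * t)"
    using sumVar t by (intro divide_right_mono) auto
  finally have "w * (\<Sum>i<s. \<Sum>v\<in>V. (Var i v + t\<^sup>2) / (4 * t))
     \<le> w * ((2 * l * pair_sum H l \<nu> + real (card V) * real s * t\<^sup>2) / (4 * t))"
    using w0 by (intro mult_left_mono)
  moreover have "Q s = (\<Sum>E\<in>H. \<nu> E * (bexp l V (\<lambda>U. of_bool (E \<subseteq> U) * of_bool (D U)) / l ^ s))"
    unfolding Q_def ini_def using img by (intro sum.cong) auto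
  ultimately show ?thesis
    using iter[of s] Q0 unfolding w_def[symmetric] e_def[symmetric]
    by (simp add: algebra_simps)
qed

section \<open>Containers\<close>

text \<open>A witness on \<open>A\<close>, extended by zero, is a witness on \<open>B\<close> with
  the same total weight and the same \<open>Lambda\<close>.\<close>

lemma downset_not_janson:
  assumes "finite V" "finite H" "0 < r"
  shows "downset V (\<lambda>L. \<not> janson L (induced H L) r K)"
  unfolding downset_def
proof (intro allI impI notI)
  fix A B assume AB: "A \<subseteq> B" "B \<subseteq> V" and B: "\<not> janson B (induced H B) r K"
    and "janson A (induced H A) r K"
  then obtain \<nu> where \<nu>: "\<forall>E\<in>induced H A. 0 \<le> \<nu> E"
    "Lambda A (induced H A) r \<nu> < (e_weight (induced H A) \<nu>)\<^sup>2 / K"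
    by (auto simp: janson_def)
  define \<nu>' where "\<nu>' = (\<lambda>E. of_bool (E \<subseteq> A) * \<nu> E)"
  have fin: "finite A" "finite B" using AB assms(1) by (auto intro: finite_subset)
  have eq: "of_bool (E \<subseteq> B) * \<nu>' E = of_bool (E \<subseteq> A) * \<nu> E" for E
    using AB by (auto simp: \<nu>'_def)
  have "Lambda B (induced H B) r \<nu>' < (e_weight (induced H B) \<nu>')\<^sup>2 / K"
    using \<nu>(2) unfolding Lambda_induced[OF assms(2) fin(1) assms(3)]
      Lambda_induced[OF assms(2) fin(2) assms(3)] e_weight_induced[OF assms(2)] eq .
  moreover have "\<forall>E\<in>induced H B. 0 \<le> \<nu>' E"
    using \<nu>(1) by (auto simp: \<nu>'_def induced_def)
  ultimately show False using B by (auto simp: janson_def)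
qed

text \<open>Quantifying over all subsets \<open>T\<close> of \<open>U\<close> makes this a down-set
  in \<open>U\<close> for any \<open>F\<close>, so a second fingerprint can be taken.\<close>

definition spread :: "real \<Rightarrow> real \<Rightarrow> 'a set \<Rightarrow> ('a set \<Rightarrow> bool) \<Rightarrow> 'a set \<Rightarrow> 'a set \<Rightarrow> bool" where
  "spread q \<delta> V F S U \<longleftrightarrow> (\<forall>T\<subseteq>U. \<delta> ^ card T * ext_prob q V F S \<le> ext_prob q V F (S \<union> T))"

lemma downset_spread: "downset V (spread q \<delta> V F S)"
  unfolding downset_def spread_def by blast

lemma downset_Un: "downset V F \<Longrightarrow> S \<subseteq> V \<Longrightarrow> downset V (\<lambda>U. F (U \<union> S))"
  unfolding downset_def by (metis Un_least Un_mono order_refl)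

text \<open>Spreadness of \<open>{v}\<close> is a condition on the single marginal of
  \<open>v\<close>, since \<open>T = {}\<close> is trivial. A set whose vertices all lie in the
  container need not itself be spread.\<close>

definition container :: "real \<Rightarrow> real \<Rightarrow> 'a set \<Rightarrow> ('a set \<Rightarrow> bool) \<Rightarrow> 'a set \<Rightarrow> 'a set" where
  "container q \<delta> V F S = {v \<in> V. spread q \<delta> V F S {v}}"

text \<open>A witness on the container is split into \<open>a0\<close>, on edges in
  \<open>F2\<close>, and \<open>a1\<close>, on the rest. The second conditioning makes
  \<open>e1\<close> small, the first makes \<open>e0\<close> small, yet they sum to
  \<open>e\<close>.\<close>

lemma container_not_janson:
  fixes p q R :: real and s :: nat and V :: "'a set" and H :: "'a set set" and S1 S2 :: "'a set"
  defines "F \<equiv> \<lambda>L. \<not> janson L (induced H L) (p / q) (1 / 2 ^ (2 * s + 2) * R)"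
    and "l \<equiv> 2 * q / real s" and "\<delta> \<equiv> 1 - 1 / (2 * real s)"
  assumes V: "finite V" "0 < card V" and H: "H \<subseteq> Pow V" "\<forall>E\<in>H. card E = s" and s: "1 \<le> s"
    and p: "0 < p" "p \<le> q / (2 ^ 10 * (real s)\<^sup>2)" and q: "0 < q" "q \<le> 1 / 16"
    and R: "p * real (card V) / 2 ^ 6 \<le> R"
    and S1: "S1 \<subseteq> V" "F S1" and S2: "S2 \<subseteq> V" "spread q (1 / 2) V F S1 S2"
  shows "\<not> janson (container l \<delta> V (spread q (1 / 2) V F S1) S2)
    (induced H (container l \<delta> V (spread q (1 / 2) V F S1) S2)) p R"
proof
  define F2 where "F2 = spread q (1 / 2) V F S1"
  define X where "X = container l \<delta> V F2 S2"
  let ?n = "real (card V)" and ?s = "real s"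
  assume "janson (container l \<delta> V (spread q (1 / 2) V F S1) S2)
    (induced H (container l \<delta> V (spread q (1 / 2) V F S1) S2)) p R"
  then obtain \<nu> where \<nu>: "\<forall>E\<in>induced H X. 0 \<le> \<nu> E"
    "Lambda X (induced H X) p \<nu> < (e_weight (induced H X) \<nu>)\<^sup>2 / R"
    by (auto simp: janson_def X_def F2_def)
  have n: "0 < ?n" and s1: "1 \<le> ?s" using V s by auto
  have finH: "finite H" using H(1) V by (simp add: finite_subset)
  have XV: "X \<subseteq> V" by (auto simp: X_def container_def)
  then have finX: "finite X" using V by (simp add: finite_subset)
  have "0 < p * ?n / 2 ^ 6" using p n by simp
  then have R0: "0 < R" using R by linarith
  have l: "0 < l" "l \<le> 1 / 8" using q s1 by (auto simp: l_def divide_le_eq)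
  have pl: "p / l \<le> 1 / (2048 * ?s)"
  proof -
    have "p / l \<le> q / (2 ^ 10 * ?s\<^sup>2) / l" using p l by (intro divide_right_mono) auto
    also have "\<dots> = 1 / (2048 * ?s)"
      using q s1 by (simp add: l_def power2_eq_square divide_simps)
    finally show ?thesis .
  qed
  also have "\<dots> \<le> 1" using s1 by (simp add: divide_le_eq)
  finally have "p \<le> l" using l by (simp add: divide_le_eq)
  define a where "a = (\<lambda>E. of_bool (E \<subseteq> X) * \<nu> E)"
  define a0 where "a0 = (\<lambda>E. of_bool (F2 E) * a E)"
  define a1 where "a1 = (\<lambda>E. of_bool (\<not> F2 E) * a E)"
  define e where "e = (\<Sum>E\<in>H. a E)"
  define e0 where "e0 = (\<Sum>E\<in>H. a0 E)"
  define e1 where "e1 = (\<Sum>E\<in>H. a1 E)"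
  have a_nonneg: "0 \<le> a E" if "E \<in> H" for E
    using \<nu>(1) that by (auto simp: a_def induced_def)
  then have a01: "0 \<le> a0 E" "a0 E \<le> a E" "0 \<le> a1 E" "a1 E \<le> a E" if "E \<in> H" for E
    using that by (auto simp: a0_def a1_def)
  have e_split: "e = e0 + e1"
    unfolding e_def e0_def e1_def a0_def a1_def sum.distrib[symmetric] by (intro sum.cong) auto
  have e_nonneg: "0 \<le> e" unfolding e_def using a_nonneg by (intro sum_nonneg)
  have pair: "pair_sum H p a < e\<^sup>2 / R"
    using \<nu>(2) unfolding Lambda_induced[OF finH finX p(1)] e_weight_induced[OF finH]
    by (simp only: a_def e_def)
  moreover have "0 \<le> pair_sum H p a" using p(1) a_nonneg by (rule pair_sum_nonneg)
  ultimately have e_pos: "0 < e" using e_nonneg by (cases "e = 0") auto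

  have "e1 \<le> e / 4"
  proof -
    define D where "D = (\<lambda>U. F2 (U \<union> S2))"
    \<comment> \<open>Chosen so that the term \<open>?n * ?s * t\<^sup>2\<close> of the error equals
      the bound \<open>e\<^sup>2 / (16 * ?n * ?s)\<close> on the pair-sum term; the whole error is
      then \<open>e / 8\<close>.\<close>
    define t where "t = e / (4 * ?n * ?s)"
    have D: "downset V D" unfolding D_def F2_def by (intro downset_Un downset_spread S2)
    have t: "0 < t" using e_pos n s1 by (simp add: t_def)
    have w: "bexp l V (\<lambda>U. of_bool (D U)) = ext_prob l V F2 S2"
      by (simp add: ext_prob_def D_def)
    have w0: "0 < bexp l V (\<lambda>U. of_bool (D U))"
    proof -
      have "0 < (1 - l) ^ card V" using l by (intro zero_less_power) auto
      also have "\<dots> \<le> ext_prob l V F2 S2" using V l S2(2) by (intro ext_prob_ge) (auto simp: F2_def)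
      finally show ?thesis unfolding w .
    qed
    have "bexp l V (\<lambda>U. of_bool (D U)) * ((1 - ?s * (1 / (2 * ?s))) * (\<Sum>E\<in>H. a1 E)
        - (2 * l * pair_sum H l a1 + ?n * ?s * t\<^sup>2) / (4 * t))
      \<le> (\<Sum>E\<in>H. a1 E * (bexp l V (\<lambda>U. of_bool (E \<subseteq> U) * of_bool (D U)) / l ^ s))"
    proof (rule edge_mass_ge)
      fix E v assume E: "E \<in> H" "a1 E \<noteq> 0" "v \<in> E"
      then have "E \<subseteq> X" by (simp add: a1_def a_def)
      then have "v \<in> X" using E(3) by blast
      then have v: "v \<in> V" "\<delta> * ext_prob l V F2 S2 \<le> ext_prob l V F2 (S2 \<union> {v})"
        by (auto simp: X_def container_def spread_def)
      have "(1 - 1 / (2 * ?s)) * l * bexp l V (\<lambda>U. of_bool (D U)) = l * (\<delta> * ext_prob l V F2 S2)"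
        unfolding w by (simp add: \<delta>_def)
      also have "\<dots> \<le> l * ext_prob l V F2 (S2 \<union> {v})"
        using v l by (intro mult_left_mono) auto
      also have "\<dots> = bexp l V (\<lambda>U. of_bool ({v} \<subseteq> U) * of_bool (D U))"
        unfolding D_def using V v by (subst bexp_superset_ext_prob) auto
      finally show "(1 - 1 / (2 * ?s)) * l * bexp l V (\<lambda>U. of_bool (D U))
        \<le> bexp l V (\<lambda>U. of_bool (v \<in> U) * of_bool (D U))" by simp
    qed (use V H l D t a01(3) in simp_all)
    \<comment> \<open>An edge inside \<open>U\<close> with \<open>D U\<close> would lie in
      \<open>F2\<close>, as \<open>F2\<close> is closed under subsets, but \<open>a1\<close>
      vanishes on \<open>F2\<close>.\<close>
    also have "\<dots> = 0"
    proof (intro sum.neutral ballI)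
      fix E assume E: "E \<in> H"
      show "a1 E * (bexp l V (\<lambda>U. of_bool (E \<subseteq> U) * of_bool (D U)) / l ^ s) = 0"
      proof (cases "F2 E")
        case False
        have "bexp l V (\<lambda>U. of_bool (E \<subseteq> U) * of_bool (D U)) = bexp l V (\<lambda>U. 0)"
        proof (intro bexp_cong)
          fix U assume U: "U \<subseteq> V"
          have "F2 E" if "E \<subseteq> U" "D U"
            using downsetD[OF D that(2,1) U] downsetD[OF downset_spread, of q "1/2" V F S1 "E \<union> S2" E]
              E H(1) S2(1) by (auto simp: D_def F2_def)
          then show "of_bool (E \<subseteq> U) * of_bool (D U) = (0::real)" using False by auto
        qed
        then show ?thesis using V by (simp add: bexp_const)
      qed (simp add: a1_def)
    qed
    finally have "(1 - ?s * (1 / (2 * ?s))) * e1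
        - (2 * l * pair_sum H l a1 + ?n * ?s * t\<^sup>2) / (4 * t) \<le> 0"
      using w0 by (simp add: mult_le_0_iff e1_def)
    \<comment> \<open>Losing \<open>1 / (2 * ?s)\<close> at each of the \<open>s\<close> steps still
      leaves half of the weight.\<close>
    moreover have "1 - ?s * (1 / (2 * ?s)) = 1 / 2" using s1 by simp
    ultimately have main: "e1 / 2 \<le> (2 * l * pair_sum H l a1 + ?n * ?s * t\<^sup>2) / (4 * t)"
      by (simp only:)
    have "pair_sum H l a1 \<le> (p / l)\<^sup>2 * pair_sum H p a1"
      using p \<open>p \<le> l\<close> a01 by (intro pair_sum_rescale) auto
    also have "\<dots> \<le> (p / l)\<^sup>2 * pair_sum H p a"
      using p a01 by (intro mult_left_mono pair_sum_mono) auto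
    also have "\<dots> \<le> (p / l)\<^sup>2 * (e\<^sup>2 / (p * ?n / 2 ^ 6))"
    proof (intro mult_left_mono)
      have "e\<^sup>2 / R \<le> e\<^sup>2 / (p * ?n / 2 ^ 6)"
        using R R0 p n by (intro divide_left_mono mult_pos_pos) auto
      then show "pair_sum H p a \<le> e\<^sup>2 / (p * ?n / 2 ^ 6)" using pair by linarith
    qed auto
    finally have "2 * l * pair_sum H l a1 \<le> 2 * l * ((p / l)\<^sup>2 * (e\<^sup>2 / (p * ?n / 2 ^ 6)))"
      using l by (intro mult_left_mono) auto
    also have "\<dots> = (p / l) * (128 * e\<^sup>2 / ?n)"
      using l p n by (simp add: power2_eq_square divide_simps)
    \<comment> \<open>The lower bound on \<open>R\<close> produced the 128; the bound on
      \<open>p\<close> now supplies 2048, and their quotient is the 16 hidden in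
      \<open>t\<close>.\<close>
    also have "\<dots> \<le> 1 / (2048 * ?s) * (128 * e\<^sup>2 / ?n)"
      using pl n by (intro mult_right_mono) auto
    also have "\<dots> = ?n * ?s * t\<^sup>2"
      using n s1 by (simp add: t_def power2_eq_square divide_simps)
    finally have "(2 * l * pair_sum H l a1 + ?n * ?s * t\<^sup>2) / (4 * t) \<le> (2 * (?n * ?s * t\<^sup>2)) / (4 * t)"
      using t by (intro divide_right_mono) linarith+
    also have "\<dots> = ?n * ?s * t / 2"
      using t by (simp add: power2_eq_square)
    also have "\<dots> = e / 8"
      using n s1 by (simp add: t_def)
    finally show ?thesis using main by linarith
  qed
  then have e0: "3 / 4 * e \<le> e0" using e_split by simp

  define D where "D = (\<lambda>U. F (U \<union> S1))"
  have dF: "downset V F"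
    unfolding F_def using V finH p q by (intro downset_not_janson) auto
  have D: "downset V D" unfolding D_def by (intro downset_Un dF S1)
  \<comment> \<open>In the power of two, \<open>2 ^ (2 * s)\<close> offsets the square of
    \<open>(1 / 2) ^ s\<close> from the marginals, one factor 2 absorbs
    \<open>(1 + p / q) ^ s\<close>, and the last gives the bound
    \<open>e\<^sup>2 / 2\<close>.\<close>
  define K where "K = 1 / 2 ^ (2 * s + 2) * R"
  have K0: "0 < K" using R0 by (simp add: K_def)
  have w: "bexp q V (\<lambda>U. of_bool (D U)) = ext_prob q V F S1"
    by (simp add: ext_prob_def D_def)
  have "((q / 2) ^ s * (\<Sum>E\<in>H. a0 E))\<^sup>2 \<le> K * (q ^ (2 * s) * (1 + p / q) ^ s * pair_sum H p a0)"
  proof (rule janson_free_weight_bound)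
    show "0 < bexp q V (\<lambda>U. of_bool (D U))"
    proof -
      have "0 < (1 - q) ^ card V" using q by (intro zero_less_power) auto
      also have "\<dots> \<le> ext_prob q V F S1" using V q S1(2) by (intro ext_prob_ge) auto
      finally show ?thesis unfolding w .
    qed
    fix E assume E: "E \<in> H" "a0 E \<noteq> 0"
    then have "F2 E" by (auto simp: a0_def)
    then have "(1 / 2) ^ card E * ext_prob q V F S1 \<le> ext_prob q V F (S1 \<union> E)"
      by (simp add: F2_def spread_def)
    then have "q ^ s * ((1 / 2) ^ s * ext_prob q V F S1) \<le> q ^ s * ext_prob q V F (S1 \<union> E)"
      using H E q by (intro mult_left_mono) auto
    then show "(q / 2) ^ s * bexp q V (\<lambda>U. of_bool (D U))
        \<le> bexp q V (\<lambda>U. of_bool (E \<subseteq> U) * of_bool (D U))"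
      unfolding w unfolding D_def using V H E
      by (subst bexp_superset_ext_prob) (auto simp: power_divide)
  next
    fix U assume U: "U \<subseteq> V" "D U"
    then have "F U" using downsetD[OF dF, of "U \<union> S1" U] S1(1) by (auto simp: D_def)
    moreover have "\<forall>E\<in>induced H U. 0 \<le> a0 E" using a01(1) by (simp add: induced_def)
    ultimately have "\<not> Lambda U (induced H U) (p / q) a0 < (e_weight (induced H U) a0)\<^sup>2 / K"
      unfolding F_def janson_def K_def by blast
    moreover have "finite U" using U V by (auto intro: finite_subset)
    ultimately show "(\<Sum>E\<in>H. of_bool (E \<subseteq> U) * a0 E)\<^sup>2
        \<le> K * pair_sum H (p / q) (\<lambda>E. of_bool (E \<subseteq> U) * a0 E)"
      using finH p q K0 by (simp add: Lambda_induced e_weight_induced not_less divide_le_eq mult.commute)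
  qed (use V H q p a01(1) D K0 in simp_all)
  also have "\<dots> \<le> K * (q ^ (2 * s) * 2 * pair_sum H p a)"
  proof -
    have "(1 + p / q) ^ s \<le> exp (p / q) ^ s"
      using p q by (intro power_mono exp_ge_add_one_self) auto
    also have "\<dots> = exp (?s * (p / q))" by (simp only: exp_of_nat_mult)
    also have "?s * (p / q) \<le> 1 / 2"
    proof -
      have "?s * (p / q) \<le> ?s * (q / (2 ^ 10 * ?s\<^sup>2) / q)"
        using p q by (intro mult_left_mono divide_right_mono) auto
      also have "\<dots> = 1 / (2 ^ 10 * ?s)" using q s1 by (simp add: power2_eq_square)
      also have "\<dots> \<le> 1 / 2" using s1 by (simp add: divide_simps)
      finally show ?thesis .
    qed
    also have "exp (1 / 2 :: real) \<le> 2"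
      using exp_half_le2 by simp
    finally have "(1 + p / q) ^ s \<le> 2" by simp
    then show ?thesis
      using K0 q p a01 pair_sum_nonneg[of p H a0]
      by (intro mult_left_mono mult_mono pair_sum_mono) auto
  qed
  also have "\<dots> < K * (q ^ (2 * s) * 2 * (e\<^sup>2 / R))"
    using pair K0 q by (intro mult_strict_left_mono) auto
  also have "\<dots> = ((q / 2) ^ s)\<^sup>2 * (e\<^sup>2 / 2)"
  proof -
    have "2 ^ (2 * s + 2) = 4 * ((2::real) ^ s)\<^sup>2" "q ^ (2 * s) = (q ^ s)\<^sup>2"
      by (simp_all add: power_even_eq power_add)
    then show ?thesis using R0 by (simp add: K_def power_divide mult_ac)
  qed
  finally have "((q / 2) ^ s)\<^sup>2 * e0\<^sup>2 < ((q / 2) ^ s)\<^sup>2 * (e\<^sup>2 / 2)"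
    by (simp add: power_mult_distrib e0_def)
  then have "e0\<^sup>2 < e\<^sup>2 / 2" using q by (simp add: mult_less_cancel_left)
  \<comment> \<open>The contradiction rests on \<open>9 / 16 > 1 / 2\<close>.\<close>
  moreover have "(3 / 4 * e)\<^sup>2 \<le> e0\<^sup>2" using e0 e_pos by (intro power_mono) auto
  moreover have "(3 / 4 * e)\<^sup>2 = 9 / 16 * e\<^sup>2" by (simp add: power_mult_distrib power2_eq_square)
  ultimately have "9 / 16 * e\<^sup>2 < e\<^sup>2 / 2" by linarith
  then show False using e_pos by simp
qed

section \<open>Counting fingerprints and assembling the containers\<close>

lemma card_small_subsets_le:
  fixes x k :: real
  assumes "finite V" "0 < x" "x \<le> 1"
  shows "real (card {S. S \<subseteq> V \<and> real (card S) \<le> k}) \<le> (1 / x) powr k * (1 + x) ^ card V"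
proof -
  let ?A = "{S. S \<subseteq> V \<and> real (card S) \<le> k}"
  have "real (card ?A) = (\<Sum>S\<in>?A. 1)" by simp
  \<comment> \<open>Exponential weighting: \<open>(1 / x) powr (k - card S)\<close> is at least 1 on
    small sets, and its sum over all subsets is a binomial expansion.\<close>
  also have "\<dots> \<le> (\<Sum>S\<in>?A. (1 / x) powr k * x ^ card S)"
  proof (intro sum_mono)
    fix S assume "S \<in> ?A"
    then have "1 \<le> (1 / x) powr (k - real (card S))"
      using assms by (intro ge_one_powr_ge_zero) auto
    also have "\<dots> = (1 / x) powr k * x ^ card S"
      using assms by (simp add: powr_diff powr_realpow power_one_over)
    finally show "1 \<le> (1 / x) powr k * x ^ card S" .
  qed
  also have "\<dots> \<le> (\<Sum>S\<in>Pow V. (1 / x) powr k * x ^ card S)"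
    using assms by (intro sum_mono2) auto
  also have "\<dots> = (1 / x) powr k * (1 + x) ^ card V"
    using assms by (simp add: sum_distrib_left[symmetric] sum_Pow_power_card)
  finally show ?thesis .
qed

text \<open>Take logarithms and use \<open>ln y \<le> y - 1\<close> twice, at
  \<open>\<delta>\<close> and at \<open>1 / (1 - q)\<close>.\<close>

lemma fingerprint_size:
  fixes q \<delta> :: real
  assumes "(1 - q) ^ n \<le> \<delta> ^ m" "0 < q" "q < 1" "0 < \<delta>"
  shows "real m * (1 - \<delta>) \<le> real n * (q / (1 - q))"
proof -
  have "real n * ln (1 - q) \<le> real m * ln \<delta>"
    using assms ln_le_cancel_iff[of "(1 - q) ^ n" "\<delta> ^ m"] by (simp add: ln_realpow)
  also have "\<dots> \<le> real m * (\<delta> - 1)"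
    using assms by (intro mult_left_mono ln_le_minus_one) auto
  finally have 1: "real m * (1 - \<delta>) \<le> real n * (- ln (1 - q))" by (simp add: algebra_simps)
  have "- ln (1 - q) = ln (1 / (1 - q))" using assms by (simp add: ln_div)
  also have "\<dots> \<le> 1 / (1 - q) - 1" using assms by (intro ln_le_minus_one) auto
  also have "\<dots> = q / (1 - q)" using assms by (simp add: field_simps)
  finally have "real n * (- ln (1 - q)) \<le> real n * (q / (1 - q))" by (intro mult_left_mono) auto
  then show ?thesis using 1 by linarith
qed

theorem theorem4p1:
  fixes s n :: nat and p q R \<eta> :: real and V :: "'a set" and H :: "'a set set"
  assumes "s \<le> n"
    and "0 < p" "0 < q" "0 < R" "0 < \<eta>"
    and "q \<le> 1/16"
    and "p \<le> q / (2^10 * real s^2)"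
    and "R \<ge> p * real n / 2^6"
    and "\<eta> = 1 / 2^(2*s+2)"
    and "finite V" "card V = n"
    and "H \<subseteq> Pow V" "\<forall>E\<in>H. card E = s"
  shows "\<exists>\<X> :: 'a set set. \<X> \<subseteq> Pow V \<and>
           real (card \<X>) \<le> 4 * (2/q) powr (8*q*real n) \<and>
           (\<forall>L. L \<subseteq> V \<longrightarrow> \<not> janson L (induced H L) (p/q) (\<eta>*R) \<longrightarrow> (\<exists>X\<in>\<X>. L \<subseteq> X)) \<and>
           (\<forall>X\<in>\<X>. \<not> janson X (induced H X) p R)"
proof -
  have "s \<noteq> 0"
  proof
    \<comment> \<open>Division by zero yields 0, so the upper bound on \<open>p\<close> would force
      \<open>p \<le> 0\<close>.\<close>
    assume "s = 0" then show False using assms(2,7) by simp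
  qed
  then have s: "1 \<le> s" "1 \<le> real s" by auto
  define F where "F = (\<lambda>L. \<not> janson L (induced H L) (p / q) (\<eta> * R))"
  define l where "l = 2 * q / real s"
  define \<delta> where "\<delta> = 1 - 1 / (2 * real s)"
  define F2 where "F2 = (\<lambda>S. spread q (1 / 2) V F S)"
  \<comment> \<open>Both limits come from \<open>fingerprint_size\<close>:
    \<open>2 * (16 / 15)\<close> from \<open>q \<le> 1 / 16\<close>, and
    \<open>2 * s * (8 / 7)\<close> times \<open>l = 2 * q / s\<close> from
    \<open>l \<le> 1 / 8\<close>.\<close>
  define k1 where "k1 = 32 / 15 * q * real n"
  define k2 where "k2 = 32 / 7 * q * real n"
  define A where "A = (\<lambda>k. {S. S \<subseteq> V \<and> real (card S) \<le> k})"
  \<comment> \<open>Membership of \<open>S1\<close> in \<open>F\<close> and of \<open>S2\<close> in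
    \<open>F2 S1\<close> is recorded because it gives the two conditioning events positive
    probability.\<close>
  define \<F> where "\<F> = {(S1, S2). S1 \<in> A k1 \<and> S2 \<in> A k2 \<and> F S1 \<and> F2 S1 S2}"
  define C where "C = (\<lambda>(S1, S2). container l \<delta> V (F2 S1) S2)"
  have l: "0 < l" "l \<le> 1 / 8" using assms(3,6) s by (auto simp: l_def divide_le_eq)
  have \<delta>: "0 < \<delta>" "\<delta> \<le> 1" using s by (auto simp: \<delta>_def divide_simps)
  have finA: "finite (A k)" for k using assms(10) by (simp add: A_def)
  have \<F>_sub: "\<F> \<subseteq> A k1 \<times> A k2" by (auto simp: \<F>_def)
  have dF: "downset V F"
    unfolding F_def using assms by (intro downset_not_janson) (auto intro: finite_subset)
  have count: "real (card (C ` \<F>)) \<le> 4 * (2 / q) powr (8 * q * real n)"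
  proof -
    let ?b = "(1 + q / 2) ^ n"
    \<comment> \<open>The choice \<open>x = q / 2\<close> gives the base \<open>2 / q\<close>, and
      the remaining \<open>(1 + q / 2) ^ (2 * n)\<close> costs at most a further
      \<open>q * n\<close> in the exponent.\<close>
    have card_A: "real (card (A k)) \<le> (2 / q) powr k * ?b" for k
      using card_small_subsets_le[of V "q / 2" k] assms by (simp add: A_def)
    have "card (C ` \<F>) \<le> card \<F>"
      using \<F>_sub finA by (intro card_image_le) (auto intro: finite_subset)
    also have "\<dots> \<le> card (A k1 \<times> A k2)" using \<F>_sub finA by (intro card_mono) auto
    finally have "real (card (C ` \<F>)) \<le> real (card (A k1)) * real (card (A k2))"
      by (simp add: card_cartesian_product flip: of_nat_mult)
    also have "\<dots> \<le> ((2 / q) powr k1 * ?b) * ((2 / q) powr k2 * ?b)"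
      using assms(3) by (intro mult_mono card_A) auto
    also have "\<dots> = (2 / q) powr (k1 + k2) * ?b\<^sup>2"
      by (simp add: powr_add power2_eq_square)
    also have "\<dots> \<le> (2 / q) powr (k1 + k2) * (2 / q) powr (q * real n)"
    proof (intro mult_left_mono)
      have "?b\<^sup>2 \<le> (exp (q / 2) ^ n)\<^sup>2"
        using assms(3) by (intro power_mono exp_ge_add_one_self) auto
      also have "\<dots> = exp (real (n * 2) * (q / 2))"
        by (simp only: power_mult exp_of_nat_mult)
      also have "real (n * 2) * (q / 2) = q * real n" by simp
      also have "exp (q * real n) \<le> exp (q * real n * ln (2 / q))"
      proof -
        have "3 \<le> 2 / q" using assms(3,6) by (simp add: le_divide_eq)
        then have "exp 1 \<le> 2 / q" using exp_le by (rule order.trans[rotated])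
        then have "1 \<le> ln (2 / q)" using assms(3) by (subst ln_ge_iff) auto
        then have "q * real n * 1 \<le> q * real n * ln (2 / q)"
          using assms(3) by (intro mult_left_mono) auto
        then show ?thesis by simp
      qed
      also have "\<dots> = (2 / q) powr (q * real n)" using assms(3) by (simp add: powr_def)
      finally show "?b\<^sup>2 \<le> (2 / q) powr (q * real n)" .
    qed auto
    also have "\<dots> = (2 / q) powr (k1 + k2 + q * real n)" by (simp add: powr_add)
    also have "\<dots> \<le> (2 / q) powr (8 * q * real n)"
    proof (intro powr_mono)
      have "k1 + k2 + q * real n = (32 / 15 + 32 / 7 + 1) * (q * real n)"
        by (simp add: k1_def k2_def algebra_simps)
      also have "\<dots> \<le> 8 * (q * real n)" using assms(3) by (intro mult_right_mono) auto
      finally show "k1 + k2 + q * real n \<le> 8 * q * real n" by simp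
      show "1 \<le> 2 / q" using assms(3,6) by (simp add: le_divide_eq)
    qed
    finally show ?thesis using powr_ge_zero[of "2 / q" "8 * q * real n"] by linarith
  qed
  have cover: "\<exists>X\<in>C ` \<F>. L \<subseteq> X" if L: "L \<subseteq> V" "F L" for L
  proof -
    obtain S1 where S1: "S1 \<subseteq> L" "(1 - q) ^ card V \<le> (1 / 2) ^ card S1"
      "\<And>T. T \<subseteq> L \<Longrightarrow> (1 / 2) ^ card T * ext_prob q V F S1 \<le> ext_prob q V F (S1 \<union> T)"
      using exists_fingerprint[OF assms(10) _ _ _ _ dF L, of q "1 / 2"] assms(3,6) by auto
    \<comment> \<open>The extension property of the first fingerprint says exactly that
      \<open>L\<close> is in the second down-set, so the fingerprint lemma applies to
      \<open>L\<close> again.\<close>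
    then have F2L: "F2 S1 L" by (simp add: F2_def spread_def)
    have dF2: "downset V (F2 S1)" unfolding F2_def by (rule downset_spread)
    obtain S2 where S2: "S2 \<subseteq> L" "(1 - l) ^ card V \<le> \<delta> ^ card S2"
      "\<And>T. T \<subseteq> L \<Longrightarrow> \<delta> ^ card T * ext_prob l V (F2 S1) S2 \<le> ext_prob l V (F2 S1) (S2 \<union> T)"
      using exists_fingerprint[OF assms(10) _ _ \<delta> dF2 L(1) F2L, of l] l by auto
    have "real (card S1) * (1 - 1 / 2) \<le> real n * (q / (1 - q))"
      using S1(2) assms by (intro fingerprint_size) auto
    also have "\<dots> \<le> real n * (q / (15 / 16))"
      using assms by (intro mult_left_mono divide_left_mono) auto
    finally have "S1 \<in> A k1" using S1(1) L(1) by (auto simp: A_def k1_def mult_ac)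
    moreover have "S2 \<in> A k2"
    proof -
      have "real (card S2) * (1 - \<delta>) \<le> real n * (l / (1 - l))"
        using S2(2) assms l \<delta> by (intro fingerprint_size) auto
      also have "\<dots> \<le> real n * (l / (7 / 8))"
        using l by (intro mult_left_mono divide_left_mono) auto
      finally have "2 * real s * (real (card S2) * (1 - \<delta>)) \<le> 2 * real s * (real n * (l / (7 / 8)))"
        by (intro mult_left_mono) auto
      moreover have "2 * real s * (real (card S2) * (1 - \<delta>)) = real (card S2)"
        using s by (simp add: \<delta>_def)
      moreover have "2 * real s * (real n * (l / (7 / 8))) = k2"
        using s by (simp add: l_def k2_def)
      ultimately show ?thesis using S2(1) L(1) by (auto simp: A_def)
    qed
    moreover have "F S1" using downsetD[OF dF L(2) S1(1) L(1)] .
    moreover have "F2 S1 S2" using F2L S2(1) by (auto simp: F2_def spread_def)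
    ultimately have "(S1, S2) \<in> \<F>" by (simp add: \<F>_def)
    moreover have "L \<subseteq> C (S1, S2)"
      using S2(3) L(1) by (auto simp: C_def container_def spread_def)
    ultimately show ?thesis by blast
  qed
  have "\<not> janson X (induced H X) p R" if "X \<in> C ` \<F>" for X
  proof -
    obtain S1 S2 where "X = C (S1, S2)" "S1 \<subseteq> V" "S2 \<subseteq> V" "F S1" "F2 S1 S2"
      using \<open>X \<in> C ` \<F>\<close> by (auto simp: \<F>_def A_def)
    then show ?thesis
      using container_not_janson[of V H s p q R S1 S2] assms s
      by (simp add: C_def F2_def F_def l_def \<delta>_def)
  qed
  moreover have "C ` \<F> \<subseteq> Pow V" by (auto simp: C_def container_def)
  ultimately show ?thesis
    using count cover unfolding F_def by (intro exI[of _ "C ` \<F>"] conjI allI impI ballI) assumption+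
qed

end
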